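(* Let $\mathcal{K}(x)=e^{-|x|}/2$ and $d>0$. Let $f:\mathbb{R}\to\mathbb{R}$ be smooth and assume there is $a\in(0,1)$ such that $f(0)=f(a)=f(1)=0$, $f<0$ on $(0,a)$, $f>0$ on $(a,1)$, $f'(0)<0$, $f'(1)<0$, $f'(a)>0$ and $\int_0^1 f(u)\,\mathrm{d}u>0$. Let $g(u):=u-\frac{f(u)}{d}$ and assume that there exist $0<\beta<\gamma<1$ such that $g'>0$ on $[0,\beta)\cup(\gamma,1]$, $g'<0$ on $(\beta,\gamma)$ and $g'(\beta)=g'(\gamma)=0$. Assume that there exists a one-parameter family of ground states with two jump discontinuities at $\pm x_0$, indexed by $v_0\in\mathcal{D}$ for some bounded domain $\mathcal{D}\subset(0,g(\beta)]$ (the family, $\mathcal{D}$, $\mathcal{G}_\pm$, $v_*$ and $v_c$ being as in the context), where $$x_0=x_0(v_0)=\int_{v_0}^{v_*}\frac{\mathrm{d}v}{\sqrt{2\left(\mathcal{G}_+(v_0)-\mathcal{G}_-(v_0)-\mathcal{G}_+(v)\right)}}.$$ Then: (i) If $g(\gamma)<0$, then $\lim_{v_0\to0^+}x_0(v_0)=0$. (ii) If $g(\gamma)>0$, then there exists $C_\gamma>0$ such that $\lim_{v_0\to g(\gamma)^+}x_0(v_0)=C_\gamma$. (iii) If $\mathcal{G}_-(g(\beta))<0$ and $-\mathcal{G}_-(g(\beta))\ge\mathcal{G}_+(1)-\mathcal{G}_+(g(\beta))$, then $\lim_{v_0\to v_c^-}x_0(v_0)=+\infty$. (iv) The map $x_0:\mathcal{D}\to\mathbb{R}^+$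 is continuous.
   Context: A ground state is a bounded, even function $U\in L^2(\mathbb{R})$, possibly discontinuous, with $0=d(-U+\mathcal{K}*U)+f(U)$ on $\mathbb{R}$, $U(\pm\infty)=0$ and $U>0$ on $\mathbb{R}$. $g_-^{-1}$ denotes the inverse of $g$ restricted to $[0,\beta]$ (defined on $[0,g(\beta)]$) and $g_+^{-1}$ the inverse of $g$ restricted to $[\gamma,1]$ (defined on $[g(\gamma),1]$). Set $$\mathcal{G}_-(V):=-\tfrac12V^2+\int_0^Vg_-^{-1}(w)\,\mathrm{d}w,\quad V\in[0,g(\beta)],\qquad \mathcal{G}_+(V):=-\tfrac12V^2-\int_V^1g_+^{-1}(w)\,\mathrm{d}w,\quad V\in[g(\gamma),1].$$ The families of discontinuous ground states in question are indexed as follows: - if $\mathcal{G}_-(g(\beta))<0$ and $-\mathcal{G}_-(g(\beta))<\mathcal{G}_+(1)-\mathcal{G}_+(g(\beta))$: by $v_0\in[g(\gamma),g(\beta)]$ with $v_0>0$; - if $\mathcal{G}_-(g(\beta))<0$ and $-\mathcal{G}_-(g(\beta))\ge\mathcal{G}_+(1)-\mathcal{G}_+(g(\beta))$: by $v_0\in[g(\gamma),v_c)$ with $v_0>0$, where $v_c$ is the unique element of $(0,g(\beta)]\cap[g(\gamma),1)$ with $\mathcal{G}_+(v_c)-\mathcal{G}_-(v_c)=\mathcal{G}_+(1)$; - if $\mathcal{G}_-(g(\beta))=0$: by $v_0\in[g(\gamma),g(\beta)]$ with $v_0>0$; - if $\mathcal{G}_-(g(\beta))>0$ and $g(\gamma)<v_m$: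 by $v_0\in[g(\gamma),v_m]$ with $v_0>0$, where $v_m\in(0,g(\beta))$ satisfies $\mathcal{G}_-(v_m)=0$ and $\mathcal{G}_-<0$ on $(0,v_m)$. For $v_0\in\mathcal{D}$, $v_*=v_*(v_0)>v_0$ satisfies $\mathcal{G}_+(v_* )=\mathcal{G}_+(v_0)-\mathcal{G}_-(v_0)$ and $\mathcal{G}_+(v_0)-\mathcal{G}_-(v_0)-\mathcal{G}_+(v)>0$ for all $v\in(v_0,v_* )$. The ground state indexed by $v_0$ is $U(x)=g_-^{-1}(V_-(x))$ for $|x|>x_0$ and $U(x)=g_+^{-1}(V_+(x))$ for $|x|<x_0$, where $V_+$ is the even solution of $V-V''=g_+^{-1}(V)$ on $[-x_0,x_0]$ with $\tfrac12(V_+')^2+\mathcal{G}_+(V_+)=\mathcal{G}_+(v_0)-\mathcal{G}_-(v_0)$, $V_+(0)=v_*$, $V_+(\pm x_0)=v_0$, and $V_-$ is the even solution of $V-V''=g_-^{-1}(V)$ on $\{|x|\ge x_0\}$ with $\tfrac12(V_-')^2+\mathcal{G}_-(V_-)=0$, $V_-(\pm x_0)=v_0$, $V_-(\pm\infty)=0$.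
   Formalization: Where G_-(v_0)=0 (endpoint v_m, or g(β) if G_-(g(β))=0) no v_*>v_0 exists; there v_*=v_0 and x_0=0 by convention, no two-jump state is assumed, and x_0>0 is claimed only at the other v_0. If g(β)>1, where G_+(g(β)) is undefined, the v_c case is taken. *)

theory Defs
  imports "HOL-Analysis.Analysis"
begin

definition smooth :: "(real \<Rightarrow> real) \<Rightarrow> bool" where
  "smooth f \<longleftrightarrow> (\<forall>n x. (deriv ^^ n) f differentiable at x)"

definition K :: "real \<Rightarrow> real" where
  "K x = exp (- \<bar>x\<bar>) / 2"

definition convolution :: "(real \<Rightarrow> real) \<Rightarrow> (real \<Rightarrow> real) \<Rightarrow> real \<Rightarrow> real" where
  "convolution k u x = (LINT y|lebesgue. k (x - y) * u y)"

definition ground_state :: "(real \<Rightarrow> real) \<Rightarrow> real \<Rightarrow> (real \<Rightarrow> real) \<Rightarrow> bool" where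
  "ground_state f d U \<longleftrightarrow>
     bounded (range U) \<and> (\<forall>x. U (- x) = U x) \<and>
     U \<in> borel_measurable lebesgue \<and> integrable lebesgue (\<lambda>x. (U x)\<^sup>2) \<and>
     (\<forall>x. 0 = d * (- U x + convolution K U x) + f (U x)) \<and>
     (U \<longlongrightarrow> 0) at_top \<and> (U \<longlongrightarrow> 0) at_bot \<and>
     (\<forall>x. U x > 0)"

definition jump_at :: "(real \<Rightarrow> real) \<Rightarrow> real \<Rightarrow> bool" where
  "jump_at U x \<longleftrightarrow>
     (\<exists>l r. (U \<longlongrightarrow> l) (at_left x) \<and> (U \<longlongrightarrow> r) (at_right x) \<and> l \<noteq> r)"

definition g :: "(real \<Rightarrow> real) \<Rightarrow> real \<Rightarrow> real \<Rightarrow> real" where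
  "g f d u = u - f u / d"

text \<open>The inverse branches are only meaningful on \<open>[0, g \<beta>]\<close> and \<open>[g \<gamma>, 1]\<close>, respectively;
  the same restrictions apply to the potentials \<open>G_minus\<close> and \<open>G_plus\<close>.\<close>

definition ginv_minus :: "(real \<Rightarrow> real) \<Rightarrow> real \<Rightarrow> real \<Rightarrow> real \<Rightarrow> real" where
  "ginv_minus f d \<beta> = the_inv_into {0..\<beta>} (g f d)"

definition ginv_plus :: "(real \<Rightarrow> real) \<Rightarrow> real \<Rightarrow> real \<Rightarrow> real \<Rightarrow> real" where
  "ginv_plus f d \<gamma> = the_inv_into {\<gamma>..1} (g f d)"

definition G_minus :: "(real \<Rightarrow> real) \<Rightarrow> real \<Rightarrow> real \<Rightarrow> real \<Rightarrow> real" where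
  "G_minus f d \<beta> V = - V\<^sup>2 / 2 + integral {0..V} (ginv_minus f d \<beta>)"

definition G_plus :: "(real \<Rightarrow> real) \<Rightarrow> real \<Rightarrow> real \<Rightarrow> real \<Rightarrow> real" where
  "G_plus f d \<gamma> V = - V\<^sup>2 / 2 - integral {V..1} (ginv_plus f d \<gamma>)"

definition case_closed :: "(real \<Rightarrow> real) \<Rightarrow> real \<Rightarrow> real \<Rightarrow> real \<Rightarrow> bool" where
  "case_closed f d \<beta> \<gamma> \<longleftrightarrow>
     G_minus f d \<beta> (g f d \<beta>) < 0 \<and> g f d \<beta> \<le> 1 \<and>
     - G_minus f d \<beta> (g f d \<beta>) < G_plus f d \<gamma> 1 - G_plus f d \<gamma> (g f d \<beta>)"

text \<open>The comparison with \<open>G_plus\<close> is imposed only when \<open>g \<beta>\<close> lies in the domain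
  \<open>[g \<gamma>, 1]\<close> of \<open>G_plus\<close>. For \<open>g \<beta> > 1\<close> the threshold \<open>v_c\<close> below still exists in \<open>(0, 1)\<close>,
  so that situation belongs to this case.\<close>

definition case_critical :: "(real \<Rightarrow> real) \<Rightarrow> real \<Rightarrow> real \<Rightarrow> real \<Rightarrow> bool" where
  "case_critical f d \<beta> \<gamma> \<longleftrightarrow>
     G_minus f d \<beta> (g f d \<beta>) < 0 \<and>
     (g f d \<beta> \<le> 1 \<longrightarrow>
        - G_minus f d \<beta> (g f d \<beta>) \<ge> G_plus f d \<gamma> 1 - G_plus f d \<gamma> (g f d \<beta>))"

definition v_c :: "(real \<Rightarrow> real) \<Rightarrow> real \<Rightarrow> real \<Rightarrow> real \<Rightarrow> real" where
  "v_c f d \<beta> \<gamma> = (THE v. v \<in> {0<..g f d \<beta>} \<inter> {g f d \<gamma>..<1} \<and>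
     G_plus f d \<gamma> v - G_minus f d \<beta> v = G_plus f d \<gamma> 1)"

definition v_m :: "(real \<Rightarrow> real) \<Rightarrow> real \<Rightarrow> real \<Rightarrow> real" where
  "v_m f d \<beta> = (THE v. v \<in> {0<..<g f d \<beta>} \<and> G_minus f d \<beta> v = 0 \<and>
     (\<forall>w\<in>{0<..<v}. G_minus f d \<beta> w < 0))"

definition family_domain :: "(real \<Rightarrow> real) \<Rightarrow> real \<Rightarrow> real \<Rightarrow> real \<Rightarrow> real set \<Rightarrow> bool" where
  "family_domain f d \<beta> \<gamma> D \<longleftrightarrow>
     (case_closed f d \<beta> \<gamma> \<and> D = {g f d \<gamma>..g f d \<beta>} \<inter> {0<..}) \<or>
     (case_critical f d \<beta> \<gamma> \<and> D = {g f d \<gamma>..<v_c f d \<beta> \<gamma>} \<inter> {0<..}) \<or>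
     (G_minus f d \<beta> (g f d \<beta>) = 0 \<and> D = {g f d \<gamma>..g f d \<beta>} \<inter> {0<..}) \<or>
     (G_minus f d \<beta> (g f d \<beta>) > 0 \<and> g f d \<gamma> < v_m f d \<beta> \<and>
        D = {g f d \<gamma>..v_m f d \<beta>} \<inter> {0<..})"

text \<open>At a right endpoint \<open>v0\<close> of the family domain with \<open>G_minus v0 = 0\<close> (that is, \<open>v0 = v_m\<close>,
  or \<open>v0 = g \<beta>\<close> when \<open>G_minus (g \<beta>) = 0\<close>) the inner orbit degenerates to a point: \<open>G_plus\<close> is
  strictly increasing to the right of \<open>v0\<close>, so no \<open>v > v0\<close> solves the defining equation.
  There the convention is \<open>v_star v0 = v0\<close>, hence \<open>x0 v0 = 0\<close>.\<close>

definition v_star :: "(real \<Rightarrow> real) \<Rightarrow> real \<Rightarrow> real \<Rightarrow> real \<Rightarrow> real \<Rightarrow> real" where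
  "v_star f d \<beta> \<gamma> v0 =
     (if G_minus f d \<beta> v0 = 0 then v0
      else (THE v. v0 < v \<and> v \<le> 1 \<and>
              G_plus f d \<gamma> v = G_plus f d \<gamma> v0 - G_minus f d \<beta> v0 \<and>
              (\<forall>w\<in>{v0<..<v}. G_plus f d \<gamma> v0 - G_minus f d \<beta> v0 - G_plus f d \<gamma> w > 0)))"

definition x0 :: "(real \<Rightarrow> real) \<Rightarrow> real \<Rightarrow> real \<Rightarrow> real \<Rightarrow> real \<Rightarrow> real" where
  "x0 f d \<beta> \<gamma> v0 = integral {v0..v_star f d \<beta> \<gamma> v0}
     (\<lambda>v. 1 / sqrt (2 * (G_plus f d \<gamma> v0 - G_minus f d \<beta> v0 - G_plus f d \<gamma> v)))"

text \<open>\<open>V\<close> is an even solution on \<open>S\<close> of \<open>V - V'' = h V\<close> with first integral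
  \<open>(V')\<^sup>2 / 2 + G V = E\<close>.\<close>

definition even_orbit ::
    "real set \<Rightarrow> (real \<Rightarrow> real) \<Rightarrow> (real \<Rightarrow> real) \<Rightarrow> real \<Rightarrow> (real \<Rightarrow> real) \<Rightarrow> bool" where
  "even_orbit S h G E V \<longleftrightarrow>
     (\<forall>x\<in>S. V (- x) = V x) \<and>
     (\<exists>V'. \<forall>x\<in>S.
        (V has_real_derivative V' x) (at x within S) \<and>
        (V' has_real_derivative (V x - h (V x))) (at x within S) \<and>
        (V' x)\<^sup>2 / 2 + G (V x) = E)"

text \<open>The values of \<open>U\<close> at the two jump points are constrained only by \<open>ground_state\<close>.\<close>

definition family_member ::
    "(real \<Rightarrow> real) \<Rightarrow> real \<Rightarrow> real \<Rightarrow> real \<Rightarrow> real \<Rightarrow> (real \<Rightarrow> real) \<Rightarrow> bool" where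
  "family_member f d \<beta> \<gamma> v0 U \<longleftrightarrow>
     (let X = x0 f d \<beta> \<gamma> v0 in
      ground_state f d U \<and>
      0 < X \<and> jump_at U X \<and> jump_at U (- X) \<and> (\<forall>x. \<bar>x\<bar> \<noteq> X \<longrightarrow> isCont U x) \<and>
      (\<exists>Vp Vm.
         even_orbit {- X..X} (ginv_plus f d \<gamma>) (G_plus f d \<gamma>)
           (G_plus f d \<gamma> v0 - G_minus f d \<beta> v0) Vp \<and>
         (\<forall>x\<in>{- X..X}. Vp x \<in> {g f d \<gamma>..1}) \<and>
         Vp 0 = v_star f d \<beta> \<gamma> v0 \<and> Vp X = v0 \<and> Vp (- X) = v0 \<and>
         even_orbit {x. X \<le> \<bar>x\<bar>} (ginv_minus f d \<beta>) (G_minus f d \<beta>) 0 Vm \<and>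
         (\<forall>x. X \<le> \<bar>x\<bar> \<longrightarrow> Vm x \<in> {0..g f d \<beta>}) \<and>
         Vm X = v0 \<and> Vm (- X) = v0 \<and> (Vm \<longlongrightarrow> 0) at_top \<and> (Vm \<longlongrightarrow> 0) at_bot \<and>
         (\<forall>x. X < \<bar>x\<bar> \<longrightarrow> U x = ginv_minus f d \<beta> (Vm x)) \<and>
         (\<forall>x. \<bar>x\<bar> < X \<longrightarrow> U x = ginv_plus f d \<gamma> (Vp x))))"

text \<open>Degenerate endpoints (see \<open>v_star\<close>) are exempt, because the ground state there is
  continuous.\<close>

definition jump_family ::
    "(real \<Rightarrow> real) \<Rightarrow> real \<Rightarrow> real \<Rightarrow> real \<Rightarrow> real set \<Rightarrow> bool" where
  "jump_family f d \<beta> \<gamma> D \<longleftrightarrow>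
     D \<noteq> {} \<and> family_domain f d \<beta> \<gamma> D \<and>
     (\<forall>v0\<in>D. G_minus f d \<beta> v0 \<noteq> 0 \<longrightarrow> (\<exists>U. family_member f d \<beta> \<gamma> v0 U))"

end

theory Submission
  imports Defs
begin

text \<open>Write \<open>E = G_plus v0 - G_minus v0\<close> and \<open>G_plus x - G_plus y = (x - y) Q x y\<close> with \<open>Q\<close> continuous.
  Since \<open>G_plus\<close> decreases and then increases, \<open>v_star\<close> is the value at \<open>E\<close> of a continuous inverse
  branch, and the substitution \<open>v = v_star - (v_star - v0) s\<^sup>2\<close> turns \<open>x0\<close> into
  \<open>sqrt (2 (v_star - v0))\<close> times the integral over \<open>[0, 1]\<close> of a positive function that is jointly
  continuous in \<open>v0\<close> and \<open>s\<close>, also at degenerate points with \<open>v_star = v0\<close>, such as \<open>v0 = 0\<close> when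
  \<open>g \<gamma> < 0\<close>. This gives (i), (ii) and (iv). As \<open>v0\<close> tends to \<open>v_c\<close>, \<open>v_star\<close> tends to \<open>1\<close>, where
  \<open>G_plus\<close> is maximal, and \<open>E - G_plus v \<le> (1 - v)\<^sup>2 / 2\<close> makes \<open>x0\<close> diverge logarithmically.
  That \<open>v_c\<close> exists at all rests on the positivity of the integral of \<open>f\<close>.\<close>


section \<open>Continuous inverses of strictly increasing functions\<close>

text \<open>The intermediate value theorem makes \<open>{F l..F r}\<close> the full image, and
  compactness of \<open>{l..r}\<close> makes the inverse continuous. This serves both branches of
  \<open>g\<close> and the turning point in the well.\<close>

lemma increasing_inverse:
  fixes F :: "real \<Rightarrow> real"
  assumes "l \<le> r" and cont: "continuous_on {l..r} F"
    and incr: "\<And>x y. l \<le> x \<Longrightarrow> x < y \<Longrightarrow> y \<le> r \<Longrightarrow> F x < F y"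
  shows "e \<in> {F l..F r} \<Longrightarrow> the_inv_into {l..r} F e \<in> {l..r}"
    and "e \<in> {F l..F r} \<Longrightarrow> F (the_inv_into {l..r} F e) = e"
    and "v \<in> {l..r} \<Longrightarrow> the_inv_into {l..r} F (F v) = v"
    and "continuous_on {F l..F r} (the_inv_into {l..r} F)"
proof -
  have inj: "inj_on F {l..r}"
    by (rule inj_onI) (metis incr atLeastAtMost_iff less_irrefl linorder_neqE_linordered_idom)
  have "F l \<le> F x \<and> F x \<le> F r" if "x \<in> {l..r}" for x
    using incr[of l x] incr[of x r] that by (cases "x = l"; cases "x = r") auto
  moreover have "e \<in> F ` {l..r}" if "e \<in> {F l..F r}" for e
    using IVT'[of F l e r] that assms by auto
  ultimately have image: "F ` {l..r} = {F l..F r}" by auto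
  show "the_inv_into {l..r} F e \<in> {l..r}" if "e \<in> {F l..F r}"
    using the_inv_into_into[OF inj] that image by blast
  show "F (the_inv_into {l..r} F e) = e" if "e \<in> {F l..F r}"
    using f_the_inv_into_f[OF inj] that image by blast
  show inv: "the_inv_into {l..r} F (F v) = v" if "v \<in> {l..r}" for v
    using the_inv_into_f_f[OF inj that] .
  have "continuous_on (F ` {l..r}) (the_inv_into {l..r} F)"
    using inv by (intro continuous_on_inv cont) auto
  then show "continuous_on {F l..F r} (the_inv_into {l..r} F)" by (simp add: image)
qed

section \<open>Travel times in an abstract potential well\<close>

text \<open>\<open>A = b\<close> is allowed: the decreasing part is then empty. Signs of
  \<open>p\<close> are required only in the open intervals, since in the application
  \<open>p B = 0\<close>.\<close>

locale potential_well =
  fixes P p :: "real \<Rightarrow> real" and A b B :: real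
  assumes A_le_b: "A \<le> b" and b_less_B: "b < B"
    and P_deriv: "v \<in> {A..B} \<Longrightarrow> (P has_real_derivative p v) (at v within {A..B})"
    and p_cont: "continuous_on {A..B} p"
    and p_neg: "v \<in> {A<..<b} \<Longrightarrow> p v < 0"
    and p_pos: "v \<in> {b<..<B} \<Longrightarrow> p v > 0"
begin

lemma P_cont: "continuous_on {A..B} P"
  using P_deriv by (meson DERIV_continuous continuous_on_eq_continuous_within)

lemma P_deriv_at: "v \<in> {A<..<B} \<Longrightarrow> (P has_real_derivative p v) (at v)"
  using P_deriv[of v] by (simp add: at_within_Icc_at)

lemma P_decreasing:
  assumes "A \<le> x" "x < y" "y \<le> b"
  shows "P y < P x"
proof (rule DERIV_neg_imp_decreasing_open[OF assms(2)])
  show "\<exists>w. (P has_real_derivative w) (at v) \<and> w < 0" if "x < v" "v < y" for v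
    using that assms b_less_B by (intro exI[of _ "p v"] conjI P_deriv_at p_neg) auto
  show "continuous_on {x..y} P"
    using assms b_less_B by (intro continuous_on_subset[OF P_cont]) auto
qed

lemma P_increasing:
  assumes "b \<le> x" "x < y" "y \<le> B"
  shows "P x < P y"
proof (rule DERIV_pos_imp_increasing_open[OF assms(2)])
  show "\<exists>w. (P has_real_derivative w) (at v) \<and> w > 0" if "x < v" "v < y" for v
    using that assms A_le_b by (intro exI[of _ "p v"] conjI P_deriv_at p_pos) auto
  show "continuous_on {x..y} P"
    using assms A_le_b by (intro continuous_on_subset[OF P_cont]) auto
qed

definition turn :: "real \<Rightarrow> real" where
  "turn = the_inv_into {b..B} P"

lemma
  shows turn_mem: "e \<in> {P b..P B} \<Longrightarrow> turn e \<in> {b..B}"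
    and P_turn: "e \<in> {P b..P B} \<Longrightarrow> P (turn e) = e"
    and turn_P: "v \<in> {b..B} \<Longrightarrow> turn (P v) = v"
    and turn_cont: "continuous_on {P b..P B} turn"
proof -
  have "continuous_on {b..B} P"
    using A_le_b by (intro continuous_on_subset[OF P_cont]) auto
  note inv = increasing_inverse[OF less_imp_le[OF b_less_B] this P_increasing, folded turn_def]
  show "e \<in> {P b..P B} \<Longrightarrow> turn e \<in> {b..B}" "e \<in> {P b..P B} \<Longrightarrow> P (turn e) = e"
    "v \<in> {b..B} \<Longrightarrow> turn (P v) = v" "continuous_on {P b..P B} turn"
    using inv by auto
qed

text \<open>The divided difference of \<open>P\<close>, written as a mean of \<open>p\<close> over
  the segment so that it makes sense and stays continuous on the diagonal.\<close>

definition Q :: "real \<Rightarrow> real \<Rightarrow> real" where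
  "Q x y = integral {0..1} (\<lambda>s. p (y + s * (x - y)))"

lemma segment_mem:
  assumes "x \<in> {A..B}" "y \<in> {A..B}" "s \<in> {0..1}"
  shows "y + s * (x - y) \<in> {A..B}"
proof -
  have "y + s * (x - y) = (1 - s) *\<^sub>R y + s *\<^sub>R x" by (simp add: algebra_simps)
  then show ?thesis
    using convexD[of "{A..B}" y x "1 - s" s] assms by auto
qed

lemma P_diff:
  assumes "x \<in> {A..B}" "y \<in> {A..B}"
  shows "P x - P y = (x - y) * Q x y"
proof -
  define l where "l s = y + s * (x - y)" for s
  have l: "l ` {0..1} \<subseteq> {A..B}"
    using segment_mem[OF assms] by (auto simp: l_def)
  have "((\<lambda>s. p (l s) * (x - y)) has_integral P (l 1) - P (l 0)) {0..1}"
  proof (rule fundamental_theorem_of_calculus)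
    fix s :: real assume s: "s \<in> {0..1}"
    have "(P has_real_derivative p (l s)) (at (l s) within l ` {0..1})"
      using has_field_derivative_subset[OF P_deriv l] l s by blast
    moreover have "(l has_real_derivative (x - y)) (at s within {0..1})"
      unfolding l_def by (auto intro!: derivative_eq_intros)
    ultimately have "(P \<circ> l has_real_derivative p (l s) * (x - y)) (at s within {0..1})"
      by (rule DERIV_image_chain)
    then show "((\<lambda>s. P (l s)) has_vector_derivative p (l s) * (x - y)) (at s within {0..1})"
      by (simp add: has_real_derivative_iff_has_vector_derivative o_def)
  qed simp
  then have "integral {0..1} (\<lambda>s. p (l s) * (x - y)) = P (l 1) - P (l 0)"
    by (rule integral_unique)
  then show ?thesis by (simp add: Q_def l_def mult.commute)
qed

lemma Q_diag: "Q x x = p x"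
  by (simp add: Q_def)

lemma Q_cont: "continuous_on ({A..B} \<times> {A..B}) (\<lambda>(x, y). Q x y)"
proof -
  have "continuous_on ({A..B} \<times> {A..B})
      (\<lambda>z. integral (cbox 0 1) (\<lambda>s. p (snd z + s * (fst z - snd z))))"
  proof (rule integral_continuous_on_param)
    have "continuous_on (({A..B} \<times> {A..B}) \<times> cbox 0 1)
       (\<lambda>w. p (snd (fst w) + snd w * (fst (fst w) - snd (fst w))))"
    proof (rule continuous_on_compose2[OF p_cont])
      show "(\<lambda>w. snd (fst w) + snd w * (fst (fst w) - snd (fst w))) `
          (({A..B} \<times> {A..B}) \<times> cbox 0 1) \<subseteq> {A..B}"
        using segment_mem by fastforce
    qed (intro continuous_intros)
    then show "continuous_on (({A..B} \<times> {A..B}) \<times> cbox 0 1)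
       (\<lambda>(z, s). p (snd z + s * (fst z - snd z)))"
      by (simp add: case_prod_unfold)
  qed
  then show ?thesis by (simp add: Q_def case_prod_unfold)
qed

text \<open>The orbit leaving \<open>v\<close> with kinetic energy \<open>m\<close> then turns back in \<open>(b, B)\<close>. The degenerate
  orbits with \<open>m = 0\<close> are included: they are where \<open>transit\<close> vanishes.\<close>

definition admissible :: "real \<Rightarrow> real \<Rightarrow> bool" where
  "admissible v m \<longleftrightarrow> v \<in> {A..B} \<and> m \<ge> 0 \<and> P v + m < P B \<and> (m = 0 \<longrightarrow> b < v)"

text \<open>For \<open>v \<le> b\<close> the energy exceeds \<open>P b\<close> because
  \<open>m = 0\<close> is excluded there, for \<open>v > b\<close> because \<open>P\<close> has
  already risen. Strictness on both sides keeps the turning point inside \<open>(b, B)\<close>,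
  where \<open>p > 0\<close>.\<close>

lemma admissible_energy:
  assumes "admissible v m"
  shows "P v + m \<in> {P b<..<P B}"
proof (cases "v \<le> b")
  case True
  then have "P b \<le> P v" using P_decreasing[of v b] assms by (cases "v = b") (auto simp: admissible_def)
  with True assms show ?thesis by (auto simp: admissible_def less_le)
next
  case False
  then have "P b < P v" using P_increasing[of b v] assms by (auto simp: admissible_def)
  with assms show ?thesis by (auto simp: admissible_def)
qed

lemma turn_strict_mem:
  assumes "admissible v m"
  shows "turn (P v + m) \<in> {b<..<B}"
  using admissible_energy[OF assms] turn_mem[of "P v + m"] P_turn[of "P v + m"]
  by (auto simp: less_le)

lemma turn_ge:
  assumes "admissible v m"
  shows "v \<le> turn (P v + m)" and "m > 0 \<Longrightarrow> v < turn (P v + m)"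
    and "m = 0 \<Longrightarrow> turn (P v + m) = v"
proof -
  let ?w = "turn (P v + m)"
  have w: "?w \<in> {b<..<B}" "P ?w = P v + m"
    using turn_strict_mem[OF assms] P_turn admissible_energy[OF assms] by auto
  have v: "v \<in> {A..B}" "m \<ge> 0" using assms by (auto simp: admissible_def)
  show 1: "v \<le> ?w" using P_increasing[of ?w v] w v by force
  show "m > 0 \<Longrightarrow> v < ?w" using 1 w by (cases "v = ?w") auto
  show "m = 0 \<Longrightarrow> turn (P v + m) = v" using assms turn_P by (auto simp: admissible_def)
qed

text \<open>Up to \<open>b\<close> the potential does not exceed \<open>P v\<close>; beyond
  \<open>b\<close> it rises strictly and reaches the energy only at the turning point. The integrand
  of \<open>transit\<close> is thus singular only there.\<close>

lemma below_turn:
  assumes "admissible v m" "m > 0" "w \<in> {v..<turn (P v + m)}"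
  shows "P w < P v + m"
proof (cases "w \<le> b")
  case True
  then have "P w \<le> P v" using P_decreasing[of v w] assms
    by (cases "w = v") (auto simp: admissible_def)
  with assms show ?thesis by simp
next
  case False
  then show ?thesis
    using P_increasing[of w "turn (P v + m)"] assms turn_strict_mem[OF assms(1)] P_turn
      admissible_energy[OF assms(1)] by auto
qed

text \<open>At the turning point \<open>Q\<close> equals \<open>p\<close>, which is positive there;
  before it, \<open>Q\<close> is a quotient of two positive differences.\<close>

lemma Q_pos:
  assumes "admissible v m" "w \<in> {v..turn (P v + m)}"
  shows "Q (turn (P v + m)) w > 0"
proof (cases "w = turn (P v + m)")
  case True
  then show ?thesis using p_pos turn_strict_mem[OF assms(1)] by (simp add: Q_diag)
next
  case False
  let ?t = "turn (P v + m)"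
  have "m \<noteq> 0" using turn_ge(3)[OF assms(1)] assms(2) False by auto
  then have "m > 0" using assms(1) by (simp add: admissible_def)
  then have "P w < P ?t"
    using below_turn[OF assms(1), of w] False assms P_turn[of "P v + m"]
      admissible_energy[OF assms(1)] by auto
  moreover have "P ?t - P w = (?t - w) * Q ?t w"
    using assms turn_strict_mem[OF assms(1)] A_le_b by (intro P_diff) (auto simp: admissible_def)
  moreover have "?t - w > 0" using False assms by simp
  ultimately show ?thesis by (metis diff_gt_0_iff_gt zero_less_mult_pos)
qed

section \<open>The travel time and its regularised integrand\<close>

text \<open>The time a Newtonian particle in the potential \<open>P\<close> takes from
  \<open>v\<close>, starting with kinetic energy \<open>m\<close>, to its turning point.\<close>

definition transit :: "real \<Rightarrow> real \<Rightarrow> real" where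
  "transit v m = integral {v..turn (P v + m)} (\<lambda>w. 1 / sqrt (2 * (P v + m - P w)))"

text \<open>With \<open>t\<close> the turning point, the integrand of \<open>transit\<close> times
  the Jacobian \<open>2 * (t - v) * s\<close> is \<open>sqrt (2 * (t - v))\<close> times this
  function for \<open>0 < s\<close>. Leaving that factor outside keeps the kernel positive on
  admissible orbits even when \<open>t = v\<close>.\<close>

definition kernel :: "real \<Rightarrow> real \<Rightarrow> real \<Rightarrow> real" where
  "kernel v m s = 1 / sqrt (Q (turn (P v + m)) (turn (P v + m) - (turn (P v + m) - v) * s\<^sup>2))"

lemma path_mem:
  fixes v t s :: real
  assumes "v \<le> t" "s \<in> {0..1}"
  shows "t - (t - v) * s\<^sup>2 \<in> {v..t}"
proof -
  have "0 \<le> (t - v) * s\<^sup>2" using assms by simp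
  moreover have "(t - v) * s\<^sup>2 \<le> (t - v) * 1"
    using assms by (intro mult_left_mono) (auto simp: power_le_one)
  ultimately show ?thesis by auto
qed

text \<open>Letting \<open>m\<close> depend on \<open>v\<close> covers the family of orbits; a
  singleton \<open>S\<close> gives continuity in \<open>s\<close> along a single orbit.\<close>

lemma kernel_cont:
  assumes "continuous_on S m" "\<And>v. v \<in> S \<Longrightarrow> admissible v (m v)"
  shows "continuous_on (S \<times> {0..1}) (\<lambda>(v, s). kernel v (m v) s)"
proof -
  define T where "T v = turn (P v + m v)" for v
  have SA: "S \<subseteq> {A..B}" using assms(2) by (auto simp: admissible_def)
  have T: "continuous_on S T" unfolding T_def
  proof (rule continuous_on_compose2[OF turn_cont])
    show "continuous_on S (\<lambda>v. P v + m v)"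
      using assms(1) continuous_on_subset[OF P_cont SA] by (intro continuous_intros)
    show "(\<lambda>v. P v + m v) ` S \<subseteq> {P b..P B}"
      using admissible_energy[OF assms(2)] by force
  qed
  have mem: "T v - (T v - v) * s\<^sup>2 \<in> {v..T v}" if "v \<in> S" "s \<in> {0..1}" for v s
    using path_mem[OF turn_ge(1)[OF assms(2)[OF that(1)]] that(2)] by (simp add: T_def)
  have Tm: "T v \<in> {b<..<B}" if "v \<in> S" for v
    using turn_strict_mem[OF assms(2)[OF that]] by (simp add: T_def)
  have T': "continuous_on (S \<times> {0..1::real}) (\<lambda>z. T (fst z))"
    by (rule continuous_on_compose2[OF T]) (auto intro!: continuous_intros)
  have sub: "(\<lambda>z. (T (fst z), T (fst z) - (T (fst z) - fst z) * (snd z)\<^sup>2)) ` (S \<times> {0..1})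
      \<subseteq> {A..B} \<times> {A..B}"
  proof clarsimp
    fix v s :: real assume vs: "v \<in> S" "0 \<le> s" "s \<le> 1"
    show "A \<le> T v \<and> T v \<le> B \<and> A \<le> T v - (T v - v) * s\<^sup>2 \<and> T v - (T v - v) * s\<^sup>2 \<le> B"
      using mem[of v s] Tm[of v] vs SA A_le_b by auto
  qed
  have "continuous_on (S \<times> {0..1})
     (\<lambda>z. (\<lambda>(x, y). Q x y) (T (fst z), T (fst z) - (T (fst z) - fst z) * (snd z)\<^sup>2))"
    by (rule continuous_on_compose2[OF Q_cont _ sub]) (intro continuous_intros T')
  then have "continuous_on (S \<times> {0..1})
     (\<lambda>z. 1 / sqrt (Q (T (fst z)) (T (fst z) - (T (fst z) - fst z) * (snd z)\<^sup>2)))"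
    using Q_pos[OF assms(2)] mem
    by (intro continuous_intros) (force simp: T_def)+
  then show ?thesis by (simp add: kernel_def T_def case_prod_unfold)
qed

text \<open>The substitution \<open>w = t - (t - v) s\<^sup>2\<close>, where \<open>t\<close> is the turning point, removes the
  inverse square root singularity at \<open>t\<close>.\<close>

lemma transit_eq:
  assumes adm: "admissible v m"
  shows "transit v m = sqrt (2 * (turn (P v + m) - v)) * integral {0..1} (kernel v m)"
    and "(\<lambda>w. 1 / sqrt (2 * (P v + m - P w))) absolutely_integrable_on {v..turn (P v + m)}"
proof -
  define t where "t = turn (P v + m)"
  define F where "F w = 1 / sqrt (2 * (P v + m - P w))" for w
  define c where "c s = t - (t - v) * s\<^sup>2" for s
  define k where "k s = sqrt (2 * (t - v)) * kernel v m s" for s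
  have t: "v \<le> t" "t \<in> {b<..<B}" "P t = P v + m" "v \<in> {A..B}"
    using turn_ge(1)[OF adm] turn_strict_mem[OF adm] P_turn[of "P v + m"]
      admissible_energy[OF adm] adm by (auto simp: t_def admissible_def)
  have "transit v m = integral {0..1} k \<and> F absolutely_integrable_on {v..t}"
  proof (cases "v = t")
    case True
    then have "turn (P v + m) = v" by (simp add: t_def)
    moreover have "k = (\<lambda>_. 0)" using True by (simp add: k_def fun_eq_iff)
    moreover have "f integrable_on {t}" for f :: "real \<Rightarrow> real"
      using integrable_on_refl[of f t] by simp
    ultimately show ?thesis
      using True by (simp add: transit_def absolutely_integrable_on_def)
  next
    case False
    then have vt: "v < t" using t by simp
    have "continuous_on ({v} \<times> {0..1}) (\<lambda>(v, s). kernel v m s)"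
      using kernel_cont[of "{v}" "\<lambda>_. m"] adm by simp
    then have "continuous_on {0..1} (\<lambda>s. (\<lambda>(v, s). kernel v m s) (v, s))"
      by (rule continuous_on_compose2) (intro continuous_intros, auto)
    then have kc: "continuous_on {0..1} k"
      by (auto intro!: continuous_intros simp: k_def)
    have inj: "inj_on c {0..1}"
      using vt by (auto simp: inj_on_def c_def)
    have img: "c ` {0..1} = {v..t}"
    proof
      show "c ` {0..1} \<subseteq> {v..t}" using path_mem[OF t(1)] by (auto simp: c_def)
      show "{v..t} \<subseteq> c ` {0..1}"
      proof
        fix w assume w: "w \<in> {v..t}"
        then have "c (sqrt ((t - w) / (t - v))) = w" using vt by (simp add: c_def field_simps)
        moreover have "sqrt ((t - w) / (t - v)) \<in> {0..1}" using vt w by auto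
        ultimately show "w \<in> c ` {0..1}" by (metis image_eqI)
      qed
    qed
    \<comment> \<open>At \<open>s = 0\<close> the identity fails: \<open>F t\<close> is
      \<open>1 / 0\<close>, hence \<open>0\<close>, while \<open>k 0\<close> is positive. A single
      point does not affect the integrals.\<close>
    have eq: "\<bar>- ((t - v) * (2 * s))\<bar> * F (c s) = k s" if s: "s \<in> {0..1} - {0}" for s
    proof -
      have cs: "c s \<in> {v..t}" using img s by blast
      have q: "Q t (c s) > 0" using Q_pos[OF adm] cs by (simp add: t_def)
      have "P t - P (c s) = (t - c s) * Q t (c s)"
        using cs t A_le_b by (intro P_diff) auto
      then have "2 * (P v + m - P (c s)) = (2 * (t - v)) * s\<^sup>2 * Q t (c s)"
        using t by (simp add: c_def)
      then have "F (c s) = 1 / (sqrt (2 * (t - v)) * s * sqrt (Q t (c s)))"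
        using s by (simp add: F_def real_sqrt_mult)
      moreover have "\<bar>- ((t - v) * (2 * s))\<bar> = 2 * (t - v) * s"
        using s vt by (simp add: abs_mult)
      moreover have "2 * (t - v) = sqrt (2 * (t - v)) * sqrt (2 * (t - v))" using vt by simp
      ultimately have "\<bar>- ((t - v) * (2 * s))\<bar> * F (c s) =
          (sqrt (2 * (t - v)) * sqrt (2 * (t - v)) * s) * (1 / (sqrt (2 * (t - v)) * s * sqrt (Q t (c s))))"
        by metis
      also have "\<dots> = sqrt (2 * (t - v)) / sqrt (Q t (c s))"
        using s vt by (simp del: real_sqrt_mult_self)
      also have "\<dots> = k s"
        by (simp add: k_def kernel_def c_def t_def)
      finally show ?thesis .
    qed
    have ki: "k absolutely_integrable_on {0..1}"
      using absolutely_integrable_continuous_real[OF kc] .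
    have neg: "negligible {0::real}" by simp
    have "(\<lambda>s. \<bar>- ((t - v) * (2 * s))\<bar> * F (c s)) absolutely_integrable_on {0..1}"
      by (rule absolutely_integrable_spike[OF ki neg]) (use eq in simp)
    moreover have "integral {0..1} (\<lambda>s. \<bar>- ((t - v) * (2 * s))\<bar> * F (c s)) = integral {0..1} k"
      by (rule integral_spike[OF neg]) (use eq in simp)
    moreover have "(c has_real_derivative - ((t - v) * (2 * s))) (at s within {0..1})" for s
      unfolding c_def by (auto intro!: derivative_eq_intros)
    \<comment> \<open>The change of variables transfers absolute integrability along with the value,
      so the singular integrand is genuinely integrable up to the turning point.\<close>
    ultimately have "F absolutely_integrable_on c ` {0..1} \<and> integral (c ` {0..1}) F = integral {0..1} k"
      using has_absolute_integral_change_of_variables_1'[of "{0..1}" c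
          "\<lambda>s. - ((t - v) * (2 * s))" F "integral {0..1} k"] inj
      by simp
    then show ?thesis unfolding img transit_def by (simp add: F_def[abs_def] t_def)
  qed
  then show "transit v m = sqrt (2 * (turn (P v + m) - v)) * integral {0..1} (kernel v m)"
    "(\<lambda>w. 1 / sqrt (2 * (P v + m - P w))) absolutely_integrable_on {v..turn (P v + m)}"
    by (simp_all add: k_def[abs_def] t_def F_def[abs_def])
qed

text \<open>After the substitution the interval is fixed and the integrand jointly continuous, so
  only the turning point and a parameter integral remain.\<close>

lemma transit_cont:
  assumes "continuous_on S m" "\<And>v. v \<in> S \<Longrightarrow> admissible v (m v)"
  shows "continuous_on S (\<lambda>v. transit v (m v))"
proof -
  have SA: "S \<subseteq> {A..B}" using assms(2) by (auto simp: admissible_def)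
  have T: "continuous_on S (\<lambda>v. turn (P v + m v))"
  proof (rule continuous_on_compose2[OF turn_cont])
    show "continuous_on S (\<lambda>v. P v + m v)"
      using assms(1) continuous_on_subset[OF P_cont SA] by (intro continuous_intros)
    show "(\<lambda>v. P v + m v) ` S \<subseteq> {P b..P B}"
      using admissible_energy[OF assms(2)] by force
  qed
  have "continuous_on S (\<lambda>v. integral (cbox 0 1) (kernel v (m v)))"
    using kernel_cont[OF assms] by (intro integral_continuous_on_param) simp_all
  with T have "continuous_on S
      (\<lambda>v. sqrt (2 * (turn (P v + m v) - v)) * integral {0..1} (kernel v (m v)))"
    by (intro continuous_intros) simp_all
  then show ?thesis
    by (rule continuous_on_eq) (simp add: transit_eq(1) assms(2))
qed

lemma transit_zero: "admissible v 0 \<Longrightarrow> transit v 0 = 0"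
  using transit_eq(1)[of v 0] turn_ge(3)[of v 0] by simp

text \<open>The continuous kernel attains a positive minimum on the compact interval
  \<open>{0..1}\<close>.\<close>

lemma transit_pos:
  assumes adm: "admissible v m" and "m > 0"
  shows "transit v m > 0"
proof -
  let ?t = "turn (P v + m)"
  have vt: "v < ?t" using turn_ge(2)[OF assms] .
  have "continuous_on ({v} \<times> {0..1}) (\<lambda>(v, s). kernel v m s)"
    using kernel_cont[of "{v}" "\<lambda>_. m"] adm by simp
  then have "continuous_on {0..1} (\<lambda>s. (\<lambda>(v, s). kernel v m s) (v, s))"
    by (rule continuous_on_compose2) (intro continuous_intros, auto)
  then have kc: "continuous_on {0..1} (kernel v m)" by simp
  then obtain s where s: "s \<in> {0..1}" "\<And>r. r \<in> {0..1} \<Longrightarrow> kernel v m s \<le> kernel v m r"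
    using continuous_attains_inf[of "{0..1::real}" "kernel v m"] by auto
  have "0 < kernel v m s"
    unfolding kernel_def using Q_pos[OF adm path_mem[OF turn_ge(1)[OF adm] s(1)]] by simp
  also have "kernel v m s = integral {0..1} (\<lambda>_::real. kernel v m s)" by simp
  also have "\<dots> \<le> integral {0..1} (kernel v m)"
    using s kc by (intro integral_le integrable_continuous_real) auto
  finally show ?thesis using vt by (simp add: transit_eq(1)[OF adm])
qed

text \<open>The bound on \<open>p\<close> makes \<open>B\<close> an at most quadratic maximum of \<open>P\<close>.\<close>

lemma transit_lower_bound:
  assumes adm: "admissible v m" and "m > 0"
    and p_le: "\<And>w. w \<in> {A..B} \<Longrightarrow> p w \<le> B - w"
  shows "ln ((B - v) / (B - turn (P v + m))) \<le> transit v m"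
proof -
  define t where "t = turn (P v + m)"
  define F where "F w = 1 / sqrt (2 * (P v + m - P w))" for w
  have t: "v < t" "t < B" "A \<le> v"
    using turn_ge(2)[OF adm] turn_strict_mem[OF adm] adm \<open>m > 0\<close>
    by (auto simp: t_def admissible_def)
  have PB: "P B - P w \<le> (B - w)\<^sup>2 / 2" if "w \<in> {A..B}" for w
  proof -
    \<comment> \<open>The term \<open>(B - B)\<^sup>2\<close> is kept so that both sides are values
      of one function, nonincreasing because its slope at \<open>x\<close> is
      \<open>p x - (B - x)\<close>.\<close>
    have "P w + (B - w)\<^sup>2 / 2 \<ge> P B + (B - B)\<^sup>2 / 2"
    proof (rule DERIV_nonpos_imp_decreasing_open[where f = "\<lambda>w. P w + (B - w)\<^sup>2 / 2"])
      show "\<exists>y. ((\<lambda>w. P w + (B - w)\<^sup>2 / 2) has_real_derivative y) (at x) \<and> y \<le> 0"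
        if "w < x" "x < B" for x
        using that \<open>w \<in> _\<close> p_le[of x]
        by (intro exI[of _ "p x + (- 1) * (B - x)"] conjI)
           (auto intro!: derivative_eq_intros P_deriv_at)
      show "continuous_on {w..B} (\<lambda>w. P w + (B - w)\<^sup>2 / 2)"
        using that by (intro continuous_intros continuous_on_subset[OF P_cont]) auto
    qed (use that in auto)
    then show ?thesis by simp
  qed
  have F_ge: "1 / (B - w) \<le> F w" if w: "w \<in> {v..t} - {t}" for w
  proof -
    have "P w < P v + m" using below_turn[OF adm \<open>m > 0\<close>, of w] w by (simp add: t_def)
    moreover have "2 * (P v + m - P w) \<le> (B - w)\<^sup>2"
      using PB[of w] w t adm by (auto simp: admissible_def)
    then have "sqrt (2 * (P v + m - P w)) \<le> B - w"
      using w t by (intro real_le_lsqrt) auto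
    ultimately show ?thesis unfolding F_def by (intro divide_left_mono) (use w t in auto)
  qed
  have "((\<lambda>w. 1 / (B - w)) has_integral - ln (B - t) - (- ln (B - v))) {v..t}"
    using t by (intro fundamental_theorem_of_calculus)
      (auto intro!: derivative_eq_intros simp: has_real_derivative_iff_has_vector_derivative[symmetric])
  moreover have "- ln (B - t) - (- ln (B - v)) = ln ((B - v) / (B - t))"
    using t by (simp add: ln_div)
  ultimately have "((\<lambda>w. 1 / (B - w)) has_integral ln ((B - v) / (B - t))) {v..t}" by simp
  \<comment> \<open>The minorant is set to \<open>0\<close> at \<open>t\<close> because
    \<open>F t = 1 / 0 = 0\<close> there.\<close>
  then have "((\<lambda>w. if w = t then 0 else 1 / (B - w)) has_integral ln ((B - v) / (B - t))) {v..t}"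
    by (rule has_integral_spike[rotated 2, where S = "{t}"]) auto
  moreover have "(F has_integral transit v m) {v..t}"
    using transit_eq(2)[OF adm] unfolding absolutely_integrable_on_def
    by (auto simp: transit_def F_def[abs_def] t_def intro: integrable_integral)
  ultimately have "ln ((B - v) / (B - t)) \<le> transit v m"
  proof (rule has_integral_le)
    fix w assume w: "w \<in> {v..t}"
    have "F t = 0" using P_turn[of "P v + m"] admissible_energy[OF adm] by (simp add: F_def t_def)
    then show "(if w = t then 0 else 1 / (B - w)) \<le> F w" using F_ge[of w] w by auto
  qed
  then show ?thesis by (simp add: t_def)
qed

end

section \<open>The bistable nonlinearity and the two inverse branches of \<open>g\<close>\<close>

locale bistable =
  fixes f :: "real \<Rightarrow> real" and d a \<beta> \<gamma> :: real
  assumes d: "d > 0"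
    and smooth: "smooth f"
    and a: "0 < a" "a < 1"
    and f_zero: "f 0 = 0" "f a = 0" "f 1 = 0"
    and f_neg: "\<And>u. u \<in> {0<..<a} \<Longrightarrow> f u < 0"
    and f_pos: "\<And>u. u \<in> {a<..<1} \<Longrightarrow> f u > 0"
    and f_integral: "integral {0..1} f > 0"
    and \<beta>\<gamma>: "0 < \<beta>" "\<beta> < \<gamma>" "\<gamma> < 1"
    and g'_pos: "\<And>u. u \<in> {0..<\<beta>} \<union> {\<gamma><..1} \<Longrightarrow> deriv (g f d) u > 0"
    and g'_neg: "\<And>u. u \<in> {\<beta><..<\<gamma>} \<Longrightarrow> deriv (g f d) u < 0"
begin

abbreviation h :: "real \<Rightarrow> real" where "h \<equiv> g f d"
abbreviation q_minus :: "real \<Rightarrow> real" where "q_minus \<equiv> ginv_minus f d \<beta>"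
abbreviation q_plus :: "real \<Rightarrow> real" where "q_plus \<equiv> ginv_plus f d \<gamma>"
abbreviation G_m :: "real \<Rightarrow> real" where "G_m \<equiv> G_minus f d \<beta>"
abbreviation G_p :: "real \<Rightarrow> real" where "G_p \<equiv> G_plus f d \<gamma>"

lemma f_differentiable: "f differentiable at u"
proof -
  have "(deriv ^^ 0) f differentiable at u" using smooth unfolding smooth_def by blast
  then show ?thesis by simp
qed

lemma h_deriv: "(h has_real_derivative deriv h u) (at u)"
proof -
  have "h differentiable at u"
    unfolding g_def[abs_def] using d f_differentiable by (intro derivative_intros) auto
  then show ?thesis by (simp add: DERIV_deriv_iff_real_differentiable)
qed

lemma h_cont: "continuous_on S h"
  using h_deriv by (meson DERIV_isCont continuous_at_imp_continuous_on)

lemma h_values: "h 0 = 0" "h 1 = 1" "h a = a"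
  by (simp_all add: g_def f_zero)

lemma h_gap: "u - h u = f u / d"
  by (simp add: g_def)

lemma h_less_left: "0 \<le> x \<Longrightarrow> x < y \<Longrightarrow> y \<le> \<beta> \<Longrightarrow> h x < h y"
  by (rule DERIV_pos_imp_increasing_open[OF _ _ h_cont])
     (use h_deriv g'_pos in \<open>auto intro!: exI\<close>)

lemma h_less_right: "\<gamma> \<le> x \<Longrightarrow> x < y \<Longrightarrow> y \<le> 1 \<Longrightarrow> h x < h y"
  by (rule DERIV_pos_imp_increasing_open[OF _ _ h_cont])
     (use h_deriv g'_pos in \<open>auto intro!: exI\<close>)

lemma h_less_middle: "\<beta> \<le> x \<Longrightarrow> x < y \<Longrightarrow> y \<le> \<gamma> \<Longrightarrow> h y < h x"
  by (rule DERIV_neg_imp_decreasing_open[OF _ _ h_cont])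
     (use h_deriv g'_neg in \<open>auto intro!: exI\<close>)

lemma h_\<beta>\<gamma>: "h \<gamma> < h \<beta>" "0 < h \<beta>" "h \<gamma> < 1"
  using h_less_middle[of \<beta> \<gamma>] h_less_left[of 0 \<beta>] h_less_right[of \<gamma> 1] \<beta>\<gamma> h_values by auto

lemma
  shows q_minus_mem: "v \<in> {0..h \<beta>} \<Longrightarrow> q_minus v \<in> {0..\<beta>}"
    and h_q_minus: "v \<in> {0..h \<beta>} \<Longrightarrow> h (q_minus v) = v"
    and q_minus_h: "u \<in> {0..\<beta>} \<Longrightarrow> q_minus (h u) = u"
    and q_minus_cont: "continuous_on {0..h \<beta>} q_minus"
  using increasing_inverse[OF less_imp_le[OF \<beta>\<gamma>(1)] h_cont h_less_left]
  unfolding ginv_minus_def h_values by auto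

lemma
  shows q_plus_mem: "v \<in> {h \<gamma>..1} \<Longrightarrow> q_plus v \<in> {\<gamma>..1}"
    and h_q_plus: "v \<in> {h \<gamma>..1} \<Longrightarrow> h (q_plus v) = v"
    and q_plus_h: "u \<in> {\<gamma>..1} \<Longrightarrow> q_plus (h u) = u"
    and q_plus_cont: "continuous_on {h \<gamma>..1} q_plus"
  using increasing_inverse[OF less_imp_le[OF \<beta>\<gamma>(3)] h_cont h_less_right]
  unfolding ginv_plus_def h_values by auto

text \<open>Monotonicity pulls bounds on \<open>v\<close> back to the branch, where the sign of
  \<open>f\<close> gives the sign of \<open>q_minus v - v\<close>.\<close>

lemma q_minus_between:
  assumes "0 \<le> l" "r \<le> \<beta>" "v \<in> {h l<..<h r}" "v \<in> {0..h \<beta>}" "l \<le> \<beta>" "0 \<le> r"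
  shows "q_minus v \<in> {l<..<r}"
proof -
  let ?u = "q_minus v"
  have u: "?u \<in> {0..\<beta>}" "h ?u = v" using assms q_minus_mem h_q_minus by auto
  then have "\<not> ?u \<le> l" "\<not> r \<le> ?u"
    using h_less_left[of ?u l] h_less_left[of r ?u] assms
    by (auto simp: le_less)
  then show ?thesis by auto
qed

lemma q_plus_between:
  assumes "\<gamma> \<le> l" "r \<le> 1" "v \<in> {h l<..<h r}" "v \<in> {h \<gamma>..1}" "l \<le> 1" "\<gamma> \<le> r"
  shows "q_plus v \<in> {l<..<r}"
proof -
  let ?u = "q_plus v"
  have u: "?u \<in> {\<gamma>..1}" "h ?u = v" using assms q_plus_mem h_q_plus by auto
  then have "\<not> ?u \<le> l" "\<not> r \<le> ?u"
    using h_less_right[of ?u l] h_less_right[of r ?u] assms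
    by (auto simp: le_less)
  then show ?thesis by auto
qed

section \<open>Monotonicity of the two potentials\<close>

lemma G_m_deriv:
  assumes "v \<in> {0..h \<beta>}"
  shows "(G_m has_real_derivative q_minus v - v) (at v within {0..h \<beta>})"
proof -
  have "((\<lambda>v. - v\<^sup>2 / 2) has_real_derivative - v) (at v within {0..h \<beta>})"
    by (auto intro!: derivative_eq_intros)
  from DERIV_add[OF this integral_has_real_derivative[OF q_minus_cont assms]]
  show ?thesis unfolding G_minus_def[abs_def] by simp
qed

text \<open>The variable is the lower limit of integration in \<open>G_plus\<close>, so the integral
  is first rewritten with the fixed lower limit \<open>h \<gamma>\<close>.\<close>

lemma G_p_deriv:
  assumes v: "v \<in> {h \<gamma>..1}"
  shows "(G_p has_real_derivative q_plus v - v) (at v within {h \<gamma>..1})"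
proof (rule has_field_derivative_transform_within[OF _ zero_less_one v])
  have "((\<lambda>v. - v\<^sup>2 / 2 - integral {h \<gamma>..1} q_plus) has_real_derivative - v)
      (at v within {h \<gamma>..1})"
    by (auto intro!: derivative_eq_intros)
  from DERIV_add[OF this integral_has_real_derivative[OF q_plus_cont v]]
  show "((\<lambda>v. - v\<^sup>2 / 2 - integral {h \<gamma>..1} q_plus + integral {h \<gamma>..v} q_plus)
      has_real_derivative q_plus v - v) (at v within {h \<gamma>..1})"
    by simp
  fix w assume w: "w \<in> {h \<gamma>..1}"
  have "integral {h \<gamma>..w} q_plus + integral {w..1} q_plus = integral {h \<gamma>..1} q_plus"
    using w by (intro Henstock_Kurzweil_Integration.integral_combine
        integrable_continuous_real q_plus_cont) auto
  then show "- w\<^sup>2 / 2 - integral {h \<gamma>..1} q_plus + integral {h \<gamma>..w} q_plus = G_p w"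
    by (simp add: G_plus_def)
qed

lemma G_m_cont: "continuous_on {0..h \<beta>} G_m"
  using G_m_deriv by (meson DERIV_continuous continuous_on_eq_continuous_within)

lemma G_m_deriv_at: "v \<in> {0<..<h \<beta>} \<Longrightarrow> (G_m has_real_derivative q_minus v - v) (at v)"
  using G_m_deriv[of v] by (simp add: at_within_Icc_at)

lemma q_minus_gap: "v \<in> {0..h \<beta>} \<Longrightarrow> q_minus v - v = f (q_minus v) / d"
  using h_gap[of "q_minus v"] h_q_minus[of v] by simp

lemma q_plus_gap: "v \<in> {h \<gamma>..1} \<Longrightarrow> q_plus v - v = f (q_plus v) / d"
  using h_gap[of "q_plus v"] h_q_plus[of v] by simp

text \<open>The slope of \<open>G_p\<close> is \<open>f (q_plus v) / d\<close>. The bottom therefore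
  lies over \<open>a\<close> if \<open>a\<close> belongs to the upper branch, and at the left end
  otherwise.\<close>

sublocale well: potential_well G_p "\<lambda>v. q_plus v - v" "h \<gamma>" "h (max a \<gamma>)" 1
proof
  show "h \<gamma> \<le> h (max a \<gamma>)"
    using h_less_right[of \<gamma> a] a by (auto simp: max_def)
  show "h (max a \<gamma>) < 1"
    using h_less_right[of "max a \<gamma>" 1] a \<beta>\<gamma> h_values by auto
  then have b1: "h (max a \<gamma>) < h 1" by (simp add: h_values)
  show "(G_p has_real_derivative q_plus v - v) (at v within {h \<gamma>..1})" if "v \<in> {h \<gamma>..1}" for v
    using G_p_deriv that .
  show "continuous_on {h \<gamma>..1} (\<lambda>v. q_plus v - v)"
    by (intro continuous_intros q_plus_cont)
  show "q_plus v - v < 0" if v: "v \<in> {h \<gamma><..<h (max a \<gamma>)}" for v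
  proof -
    have "v \<in> {h \<gamma>..1}" using v b1 h_values by auto
    moreover have "q_plus v \<in> {\<gamma><..<max a \<gamma>}"
      using v a \<beta>\<gamma> calculation by (intro q_plus_between) auto
    then have "f (q_plus v) < 0"
      using \<beta>\<gamma> by (intro f_neg) auto
    ultimately show ?thesis using d by (simp add: q_plus_gap divide_neg_pos)
  qed
  show "0 < q_plus v - v" if v: "v \<in> {h (max a \<gamma>)<..<1}" for v
  proof -
    have "v \<in> {h \<gamma>..1}" using v \<open>h \<gamma> \<le> h (max a \<gamma>)\<close> by auto
    moreover have "q_plus v \<in> {max a \<gamma><..<1}"
      using v a \<beta>\<gamma> calculation h_values by (intro q_plus_between) auto
    then have "f (q_plus v) > 0" by (intro f_pos) auto
    ultimately show ?thesis using d by (simp add: q_plus_gap)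
  qed
qed

lemma G_m_0: "G_m 0 = 0"
  by (simp add: G_minus_def)

lemma h_min: "0 < h (min a \<beta>)" "h (min a \<beta>) \<le> h \<beta>"
  using h_less_left[of 0 "min a \<beta>"] h_less_left[of a \<beta>] a \<beta>\<gamma> h_values
  by (auto simp: min_def le_less)

text \<open>The slope of \<open>G_m\<close> is \<open>f (q_minus v) / d\<close>, so the minimum lies
  over \<open>a\<close>, or at the right end if \<open>a\<close> is beyond the lower branch.\<close>

lemma G_m_decreasing:
  assumes "0 \<le> x" "x < y" "y \<le> h (min a \<beta>)"
  shows "G_m y < G_m x"
proof (rule DERIV_neg_imp_decreasing_open[OF assms(2)])
  show "\<exists>w. (G_m has_real_derivative w) (at v) \<and> w < 0" if v: "x < v" "v < y" for v
  proof (intro exI conjI)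
    have v': "v \<in> {0<..<h \<beta>}" using v assms h_min by auto
    then show "(G_m has_real_derivative q_minus v - v) (at v)" by (rule G_m_deriv_at)
    have "q_minus v \<in> {0<..<min a \<beta>}"
      using v v' assms a \<beta>\<gamma> h_values by (intro q_minus_between) auto
    then have "f (q_minus v) < 0" by (intro f_neg) auto
    then show "q_minus v - v < 0" using d v' by (simp add: q_minus_gap divide_neg_pos)
  qed
  show "continuous_on {x..y} G_m"
    using assms h_min by (intro continuous_on_subset[OF G_m_cont]) auto
qed

lemma G_m_increasing:
  assumes "h (min a \<beta>) \<le> x" "x < y" "y \<le> h \<beta>"
  shows "G_m x < G_m y"
proof (rule DERIV_pos_imp_increasing_open[OF assms(2)])
  show "\<exists>w. (G_m has_real_derivative w) (at v) \<and> w > 0" if v: "x < v" "v < y" for v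
  proof (intro exI conjI)
    have v': "v \<in> {0<..<h \<beta>}" using v assms h_min by auto
    then show "(G_m has_real_derivative q_minus v - v) (at v)" by (rule G_m_deriv_at)
    have "q_minus v \<in> {min a \<beta><..<\<beta>}"
      using v v' assms a \<beta>\<gamma> by (intro q_minus_between) auto
    then have "f (q_minus v) > 0" using \<beta>\<gamma> by (intro f_pos) auto
    then show "q_minus v - v > 0" using d v' by (simp add: q_minus_gap)
  qed
  show "continuous_on {x..y} G_m"
    using assms h_min by (intro continuous_on_subset[OF G_m_cont]) auto
qed

text \<open>Starting from \<open>G_m 0 = 0\<close>, \<open>G_m\<close> falls and then rises, so it
  cannot return to \<open>0\<close> before a point where it is still nonpositive.\<close>

lemma G_m_neg:
  assumes "0 < v" "v \<le> w" "w \<le> h \<beta>" "G_m w < 0 \<or> v < w \<and> G_m w = 0"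
  shows "G_m v < 0"
proof (cases "v \<le> h (min a \<beta>)")
  case True
  then show ?thesis using G_m_decreasing[of 0 v] G_m_0 assms by auto
next
  case False
  then have "v < w \<Longrightarrow> G_m v < G_m w" using G_m_increasing[of v w] assms by linarith
  then show ?thesis using assms by (cases "v = w") auto
qed

text \<open>Otherwise \<open>G_m\<close> would decrease from \<open>0\<close> on its whole
  domain.\<close>

lemma a_less_\<beta>:
  assumes "G_m (h \<beta>) \<ge> 0"
  shows "a < \<beta>"
proof (rule ccontr)
  assume "\<not> a < \<beta>"
  then have "min a \<beta> = \<beta>" by simp
  then show False using G_m_decreasing[of 0 "h \<beta>"] h_\<beta>\<gamma> G_m_0 assms by simp
qed

lemma h_\<beta>_less_1:
  assumes "a < \<beta>"
  shows "h \<beta> < 1"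
proof -
  have "f \<beta> > 0" using assms \<beta>\<gamma> by (intro f_pos) auto
  then have "\<beta> - h \<beta> > 0" using d by (simp add: h_gap)
  then show ?thesis using \<beta>\<gamma> by simp
qed

section \<open>The energy of the inner orbit and its comparison with the top of the well\<close>

text \<open>The outer orbit has total energy \<open>0\<close>, so it arrives at \<open>v\<close>
  with kinetic energy \<open>- G_m v\<close>, which the inner orbit inherits.\<close>

definition energy :: "real \<Rightarrow> real" where
  "energy v = G_p v - G_m v"

definition common :: "real set" where
  "common = {max 0 (h \<gamma>)..min (h \<beta>) 1}"

lemma common_iff: "v \<in> common \<longleftrightarrow> v \<in> {0..h \<beta>} \<and> v \<in> {h \<gamma>..1}"
  by (auto simp: common_def)

lemma energy_cont: "continuous_on common energy"
  unfolding energy_def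
  by (intro continuous_intros continuous_on_subset[OF well.P_cont] continuous_on_subset[OF G_m_cont])
     (auto simp: common_def)

text \<open>The derivative of \<open>energy\<close> is the size \<open>q_plus - q_minus \<ge> \<gamma> - \<beta>\<close> of the jump.\<close>

lemma energy_increasing:
  assumes "x \<in> common" "y \<in> common" "x < y"
  shows "energy x < energy y"
proof (rule DERIV_pos_imp_increasing_open[OF assms(3)])
  show "\<exists>w. (energy has_real_derivative w) (at v) \<and> w > 0" if v: "x < v" "v < y" for v
  proof (intro exI conjI)
    have v': "v \<in> {0<..<h \<beta>}" "v \<in> {h \<gamma><..<1}" using v assms by (auto simp: common_def)
    show "(energy has_real_derivative (q_plus v - v) - (q_minus v - v)) (at v)"
      unfolding energy_def[abs_def]
      by (intro derivative_intros G_m_deriv_at well.P_deriv_at v')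
    show "(q_plus v - v) - (q_minus v - v) > 0"
      using q_plus_mem[of v] q_minus_mem[of v] v' \<beta>\<gamma> by auto
  qed
  show "continuous_on {x..y} energy"
    using assms by (intro continuous_on_subset[OF energy_cont]) (auto simp: common_def)
qed

text \<open>A common primitive of \<open>(u - g u) g' u\<close>, the derivative of \<open>G_m (g u)\<close> and of \<open>G_p (g u)\<close>.\<close>

definition primitive :: "real \<Rightarrow> real" where
  "primitive u = u * h u - integral {0..u} h - (h u)\<^sup>2 / 2"

lemma primitive_deriv:
  assumes "u \<in> {0..1}"
  shows "(primitive has_real_derivative (u - h u) * deriv h u) (at u within {0..1})"
proof -
  note h = has_field_derivative_at_within[OF h_deriv]
  have "((\<lambda>u. u * h u - (h u)\<^sup>2 / 2) has_real_derivative h u + (u - h u) * deriv h u)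
      (at u within {0..1})"
    by (auto intro!: derivative_eq_intros h simp: algebra_simps)
  from DERIV_diff[OF this integral_has_real_derivative[OF h_cont assms]]
  show ?thesis unfolding primitive_def[abs_def] by (simp add: algebra_simps)
qed

text \<open>By the chain rule and \<open>q_minus (h u) = u\<close> both sides have the same
  derivative, and both vanish at \<open>0\<close>.\<close>

lemma G_m_h:
  assumes "u \<in> {0..\<beta>}"
  shows "G_m (h u) = primitive u"
proof -
  have "\<exists>c. \<forall>u\<in>{0..\<beta>}. G_m (h u) - primitive u = c"
  proof (rule has_field_derivative_zero_constant)
    fix u assume u: "u \<in> {0..\<beta>}"
    have sub: "h ` {0..\<beta>} \<subseteq> {0..h \<beta>}"
      using h_less_left h_values \<beta>\<gamma> by (force simp: le_less)
    have "h u \<in> {0..h \<beta>}" using sub u by blast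
    then have "(G_m \<circ> h has_real_derivative (q_minus (h u) - h u) * deriv h u) (at u within {0..\<beta>})"
      using u sub by (intro DERIV_image_chain has_field_derivative_subset[OF G_m_deriv sub]
          has_field_derivative_at_within[OF h_deriv]) auto
    moreover have "(primitive has_real_derivative (u - h u) * deriv h u) (at u within {0..\<beta>})"
      using u \<beta>\<gamma> by (intro has_field_derivative_subset[OF primitive_deriv]) auto
    ultimately show "((\<lambda>u. G_m (h u) - primitive u) has_real_derivative 0) (at u within {0..\<beta>})"
      using DERIV_diff q_minus_h[OF u] by (fastforce simp: o_def)
  qed simp
  moreover have "G_m (h 0) - primitive 0 = 0"
    by (simp add: primitive_def h_values G_m_0)
  ultimately show ?thesis using assms \<beta>\<gamma> by fastforce
qed

text \<open>The same comparison of derivatives; the unknown constant cancels in the difference with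
  the value at \<open>1\<close>.\<close>

lemma G_p_h:
  assumes "u \<in> {\<gamma>..1}"
  shows "G_p 1 - G_p (h u) = primitive 1 - primitive u"
proof -
  have "\<exists>c. \<forall>u\<in>{\<gamma>..1}. G_p (h u) - primitive u = c"
  proof (rule has_field_derivative_zero_constant)
    fix u assume u: "u \<in> {\<gamma>..1}"
    have sub: "h ` {\<gamma>..1} \<subseteq> {h \<gamma>..1}"
      using h_less_right h_values \<beta>\<gamma> by (force simp: le_less)
    have "h u \<in> {h \<gamma>..1}" using sub u by blast
    then have "(G_p \<circ> h has_real_derivative (q_plus (h u) - h u) * deriv h u) (at u within {\<gamma>..1})"
      using u sub by (intro DERIV_image_chain has_field_derivative_subset[OF G_p_deriv sub]
          has_field_derivative_at_within[OF h_deriv]) auto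
    moreover have "(primitive has_real_derivative (u - h u) * deriv h u) (at u within {\<gamma>..1})"
      using u \<beta>\<gamma> by (intro has_field_derivative_subset[OF primitive_deriv]) auto
    ultimately show "((\<lambda>u. G_p (h u) - primitive u) has_real_derivative 0) (at u within {\<gamma>..1})"
      using DERIV_diff q_plus_h[OF u] by (fastforce simp: o_def)
  qed simp
  then have "G_p (h 1) - primitive 1 = G_p (h u) - primitive u" using assms \<beta>\<gamma> by auto
  then show ?thesis by (simp add: h_values)
qed

text \<open>With \<open>u = q_minus (g \<gamma>)\<close>, the energy gap is the sum of the integral of \<open>f / d\<close> over \<open>[0, 1]\<close>
  and of the integral of \<open>g - g \<gamma> \<ge> 0\<close> over \<open>[u, \<gamma>]\<close>.\<close>

lemma energy_h_\<gamma>: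
  assumes "h \<gamma> > 0"
  shows "energy (h \<gamma>) < G_p 1"
proof -
  let ?u = "q_minus (h \<gamma>)"
  have u: "?u \<in> {0..\<beta>}" "h ?u = h \<gamma>"
    using q_minus_mem[of "h \<gamma>"] h_q_minus[of "h \<gamma>"] assms h_\<beta>\<gamma> by auto
  have hi: "h integrable_on {x..y}" for x y
    by (intro integrable_continuous_real h_cont)
  have f_cont: "continuous_on {0..1} f"
    using f_differentiable by (simp add: continuous_at_imp_continuous_on differentiable_imp_continuous_within)
  have "integral {0..1} h = integral {0..1} (\<lambda>u. u) - integral {0..1} (\<lambda>u. f u / d)"
    unfolding g_def[abs_def] using f_cont d
    by (intro integral_diff integrable_continuous_real continuous_intros) auto
  also have "integral {0..1} (\<lambda>u. u) = (1 / 2 :: real)"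
    using ident_has_integral[of 0 "1::real"] by (simp add: integral_unique)
  also have "integral {0..1} (\<lambda>u. f u / d) = integral {0..1} f / d" by simp
  finally have "integral {0..1} h < 1 / 2" using f_integral d by simp
  \<comment> \<open>\<open>primitive 1\<close> is \<open>1 / 2\<close> minus the integral of
    \<open>h\<close>, that is, the integral of \<open>f / d\<close>.\<close>
  then have 1: "primitive 1 > 0" by (simp add: primitive_def h_values)
  have "integral {?u..\<gamma>} (\<lambda>_. h \<gamma>) \<le> integral {?u..\<gamma>} h"
  proof (intro integral_le hi integrable_continuous_real continuous_intros)
    \<comment> \<open>From \<open>?u\<close>, where it equals \<open>h \<gamma>\<close>,
      \<open>h\<close> rises up to \<open>\<beta>\<close> and then falls back to
      \<open>h \<gamma>\<close> at \<open>\<gamma>\<close>.\<close>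
    fix w assume w: "w \<in> {?u..\<gamma>}"
    show "h \<gamma> \<le> h w"
    proof (cases "w \<le> \<beta>")
      case True
      then show ?thesis using h_less_left[of ?u w] u w by (cases "w = ?u") auto
    next
      case False
      then show ?thesis using h_less_middle[of w \<gamma>] w by (cases "w = \<gamma>") auto
    qed
  qed
  moreover have "integral {0..?u} h + integral {?u..\<gamma>} h = integral {0..\<gamma>} h"
    using u \<beta>\<gamma> by (intro Henstock_Kurzweil_Integration.integral_combine hi) auto
  ultimately have "primitive \<gamma> \<le> primitive ?u"
    using u \<beta>\<gamma> by (simp add: primitive_def algebra_simps)
  with 1 show ?thesis
    using G_m_h[OF u(1)] u(2) G_p_h[of \<gamma>] \<beta>\<gamma> by (simp add: energy_def)
qed

text \<open>Otherwise \<open>\<gamma> < a\<close>, which rules out \<open>a < \<beta>\<close>;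
  moreover \<open>f \<gamma> < 0\<close> then gives
  \<open>h \<gamma> > \<gamma> > 0\<close>.\<close>

lemma h_max: "h \<gamma> \<le> 0 \<or> a < \<beta> \<Longrightarrow> h (max a \<gamma>) = h \<gamma>"
proof (rule ccontr)
  assume *: "h \<gamma> \<le> 0 \<or> a < \<beta>" and "h (max a \<gamma>) \<noteq> h \<gamma>"
  then have "\<gamma> < a" by (auto simp: max_def split: if_splits)
  then have "f \<gamma> < 0" using \<beta>\<gamma> by (intro f_neg) auto
  then have "\<gamma> - h \<gamma> < 0" using d by (simp add: h_gap divide_neg_pos)
  then show False using * \<open>\<gamma> < a\<close> \<beta>\<gamma> by auto
qed

text \<open>If \<open>h \<gamma> \<le> 0\<close>, the orbit from \<open>0\<close> has no kinetic
  energy and \<open>G_p\<close> increases all the way from \<open>0\<close> to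
  \<open>1\<close>.\<close>

lemma energy_bottom: "energy (max 0 (h \<gamma>)) < G_p 1"
proof (cases "h \<gamma> > 0")
  case True
  then show ?thesis using energy_h_\<gamma> by simp
next
  case False
  then have "G_p 0 < G_p 1" using h_max by (intro well.P_increasing) auto
  then show ?thesis using False G_m_0 by (simp add: energy_def)
qed

section \<open>The function \<open>x0\<close> as a travel time\<close>

text \<open>The set on which the inner orbit is admissible. It contains \<open>0\<close> when
  \<open>h \<gamma> < 0\<close>, although \<open>0\<close> is outside the family, so that the limit
  there is a value of \<open>x0\<close>.\<close>

definition regular :: "real set" where
  "regular = {v \<in> common. G_m v \<le> 0 \<and> energy v < G_p 1 \<and> (G_m v = 0 \<longrightarrow> h (max a \<gamma>) < v)}"

lemma regular_admissible: "v \<in> regular \<Longrightarrow> well.admissible v (- G_m v)"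
  by (auto simp: regular_def well.admissible_def common_iff energy_def)

text \<open>A larger candidate would have the turning point in its open interval, where
  \<open>G_p\<close> must stay below the energy; a smaller one is excluded by
  \<open>below_turn\<close>. The degenerate convention agrees with \<open>turn\<close>.\<close>

lemma v_star_eq:
  assumes "v \<in> regular"
  shows "v_star f d \<beta> \<gamma> v = well.turn (energy v)"
proof (cases "G_m v = 0")
  case True
  then show ?thesis
    using well.turn_ge(3)[OF regular_admissible[OF assms]] by (simp add: v_star_def energy_def)
next
  case False
  note adm = regular_admissible[OF assms]
  let ?t = "well.turn (energy v)"
  have m: "- G_m v > 0" using False assms by (simp add: regular_def)
  have t: "v < ?t" "?t < 1" "G_p ?t = energy v"
    using well.turn_ge(2)[OF adm m] well.turn_strict_mem[OF adm] well.admissible_energy[OF adm]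
      well.P_turn[of "energy v"] by (auto simp: energy_def)
  have below: "G_p w < energy v" if "w \<in> {v<..<?t}" for w
    using well.below_turn[OF adm m, of w] that by (auto simp: energy_def)
  have "(THE w. v < w \<and> w \<le> 1 \<and> G_p w = energy v \<and> (\<forall>z\<in>{v<..<w}. energy v - G_p z > 0)) = ?t"
  proof (rule the_equality)
    show "v < ?t \<and> ?t \<le> 1 \<and> G_p ?t = energy v \<and> (\<forall>z\<in>{v<..<?t}. energy v - G_p z > 0)"
      using t below by auto
    fix w assume w: "v < w \<and> w \<le> 1 \<and> G_p w = energy v \<and> (\<forall>z\<in>{v<..<w}. energy v - G_p z > 0)"
    then have "?t \<in> {v<..<w} \<Longrightarrow> energy v - G_p ?t > 0" by blast
    then have "\<not> ?t < w" using t(1,3) by auto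
    moreover have "\<not> w < ?t" using w below[of w] by auto
    ultimately show "w = ?t" by simp
  qed
  then show ?thesis using False by (simp add: v_star_def energy_def)
qed

lemma x0_eq:
  assumes "v \<in> regular"
  shows "x0 f d \<beta> \<gamma> v = well.transit v (- G_m v)"
  using v_star_eq[OF assms] by (simp add: x0_def well.transit_def energy_def)

lemma x0_cont: "continuous_on regular (x0 f d \<beta> \<gamma>)"
proof -
  have "continuous_on regular G_m"
    by (rule continuous_on_subset[OF G_m_cont]) (auto simp: regular_def common_iff)
  then have "continuous_on regular (\<lambda>v. well.transit v (- G_m v))"
    using regular_admissible by (intro well.transit_cont continuous_intros) auto
  then show ?thesis by (rule continuous_on_eq) (simp add: x0_eq)
qed

lemma x0_pos: "v \<in> regular \<Longrightarrow> G_m v \<noteq> 0 \<Longrightarrow> 0 < x0 f d \<beta> \<gamma> v"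
  unfolding x0_eq by (intro well.transit_pos regular_admissible) (auto simp: regular_def)

lemma x0_zero: "v \<in> regular \<Longrightarrow> G_m v = 0 \<Longrightarrow> x0 f d \<beta> \<gamma> v = 0"
  using x0_eq[of v] regular_admissible[of v] well.transit_zero[of v] by simp

lemma x0_tendsto_at_right:
  assumes "v < w" "{v..w} \<subseteq> regular"
  shows "(x0 f d \<beta> \<gamma> \<longlongrightarrow> x0 f d \<beta> \<gamma> v) (at_right v)"
proof -
  have "(x0 f d \<beta> \<gamma> \<longlongrightarrow> x0 f d \<beta> \<gamma> v) (at v within {v..w})"
    using continuous_on_subset[OF x0_cont assms(2)] assms(1) by (auto simp: continuous_on_def)
  then show ?thesis using assms(1) by (simp add: at_within_Icc_at_right)
qed

section \<open>The thresholds \<open>v_c\<close> and \<open>v_m\<close>, and regularity of the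
  family\<close>

text \<open>On \<open>common\<close> the energy rises strictly from below \<open>G_p 1\<close> to at
  least \<open>G_p 1\<close>, which yields existence and uniqueness.\<close>

lemma v_c_props:
  assumes "case_critical f d \<beta> \<gamma>"
  shows "v_c f d \<beta> \<gamma> \<in> common" "max 0 (h \<gamma>) < v_c f d \<beta> \<gamma>" "v_c f d \<beta> \<gamma> < 1"
    "energy (v_c f d \<beta> \<gamma>) = G_p 1"
proof -
  have neg: "G_m v < 0" if "0 < v" "v \<le> h \<beta>" for v
    using G_m_neg[of v "h \<beta>"] assms that by (simp add: case_critical_def)
  define lo hi where "lo = max 0 (h \<gamma>)" and "hi = min (h \<beta>) 1"
  have lohi: "lo < hi" using h_\<beta>\<gamma> by (auto simp: lo_def hi_def)
  have common: "common = {lo..hi}" by (simp add: common_def lo_def hi_def)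
  have "G_p 1 \<le> energy hi"
  proof (cases "h \<beta> \<le> 1")
    case True
    then show ?thesis using assms by (auto simp: case_critical_def energy_def hi_def)
  next
    case False
    then show ?thesis using neg[of 1] by (auto simp: energy_def hi_def)
  qed
  moreover have lo: "energy lo < G_p 1" using energy_bottom by (simp add: lo_def)
  ultimately obtain v where v: "lo \<le> v" "v \<le> hi" "energy v = G_p 1"
    using IVT'[of energy lo "G_p 1" hi] lohi energy_cont common by auto
  have "v \<noteq> lo" using lo v by auto
  \<comment> \<open>At \<open>1\<close> the energy would be
    \<open>G_p 1 - G_m 1 > G_p 1\<close>.\<close>
  have "v \<noteq> 1"
  proof
    assume "v = 1"
    then show False using neg[of 1] v by (simp add: energy_def hi_def)
  qed
  have "v_c f d \<beta> \<gamma> = v"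
    unfolding v_c_def
  proof (rule the_equality)
    show "v \<in> {0<..h \<beta>} \<inter> {h \<gamma>..<1} \<and> G_p v - G_m v = G_p 1"
      using v \<open>v \<noteq> lo\<close> \<open>v \<noteq> 1\<close> by (auto simp: lo_def hi_def energy_def)
    fix w assume "w \<in> {0<..h \<beta>} \<inter> {h \<gamma>..<1} \<and> G_p w - G_m w = G_p 1"
    then have "w \<in> common" "energy w = G_p 1" by (auto simp: common_iff energy_def)
    moreover have "v \<in> common" using v by (simp add: common)
    ultimately show "w = v"
      using energy_increasing[of v w] energy_increasing[of w v] v by fastforce
  qed
  then show "v_c f d \<beta> \<gamma> \<in> common" "max 0 (h \<gamma>) < v_c f d \<beta> \<gamma>" "v_c f d \<beta> \<gamma> < 1"
    "energy (v_c f d \<beta> \<gamma>) = G_p 1"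
    using v \<open>v \<noteq> lo\<close> \<open>v \<noteq> 1\<close> by (auto simp: common lo_def[symmetric] hi_def)
qed

text \<open>The zero lies on the increasing part, between the negative minimum and
  \<open>h \<beta>\<close>; \<open>G_m_neg\<close> excludes any other candidate.\<close>

lemma v_m_props:
  assumes "G_m (h \<beta>) > 0"
  shows "v_m f d \<beta> \<in> {0<..<h \<beta>}" "G_m (v_m f d \<beta>) = 0"
proof -
  let ?b = "h (min a \<beta>)"
  have "G_m ?b < 0" using G_m_decreasing[of 0 ?b] h_min G_m_0 by simp
  moreover have "continuous_on {?b..h \<beta>} G_m"
    using h_min by (intro continuous_on_subset[OF G_m_cont]) auto
  ultimately obtain v where v: "?b \<le> v" "v \<le> h \<beta>" "G_m v = 0"
    using IVT'[of G_m ?b 0 "h \<beta>"] assms h_min(2) by (meson less_imp_le)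
  then have v0: "0 < v" "v < h \<beta>" using h_min assms by (auto simp: less_le)
  have "v_m f d \<beta> = v"
    unfolding v_m_def
  proof (rule the_equality)
    show "v \<in> {0<..<h \<beta>} \<and> G_m v = 0 \<and> (\<forall>w\<in>{0<..<v}. G_m w < 0)"
      using v v0 G_m_neg[of _ v] by auto
    fix w assume w: "w \<in> {0<..<h \<beta>} \<and> G_m w = 0 \<and> (\<forall>z\<in>{0<..<w}. G_m z < 0)"
    then have "v \<in> {0<..<w} \<Longrightarrow> G_m v < 0" by blast
    then show "w = v"
      using v v0 w G_m_neg[of w v] by (cases w v rule: linorder_cases) auto
  qed
  then show "v_m f d \<beta> \<in> {0<..<h \<beta>}" "G_m (v_m f d \<beta>) = 0" using v v0 by auto
qed

text \<open>\<open>w\<close> is the zero of \<open>G_m\<close> that ends the family when \<open>G_m (g \<beta>) \<ge> 0\<close>.\<close>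

lemma regular_upto_zero:
  assumes "G_m (h \<beta>) \<ge> 0" "G_m w = 0" "w \<in> {0<..h \<beta>}" "h \<gamma> < w" "v \<in> {h \<gamma>..w}" "0 < v"
  shows "v \<in> regular"
proof -
  note a_less_\<beta>[OF assms(1)]
  \<comment> \<open>\<open>a < \<beta>\<close> puts \<open>h \<beta>\<close> below \<open>1\<close>
    and makes \<open>G_p\<close> increase on its whole domain.\<close>
  then have w1: "w < 1" and b: "h (max a \<gamma>) = h \<gamma>" using h_\<beta>_less_1 h_max assms by auto
  have "energy w = G_p w" using assms by (simp add: energy_def)
  also have "\<dots> < G_p 1" using assms w1 b by (intro well.P_increasing) auto
  finally have w: "energy w < G_p 1" .
  have wc: "w \<in> common" "v \<in> common" using assms w1 by (auto simp: common_iff)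
  show ?thesis
  proof (cases "v = w")
    case True
    then show ?thesis using w assms wc b by (simp add: regular_def)
  next
    case False
    then have "energy v < energy w" "G_m v < 0"
      using energy_increasing[OF wc(2,1)] G_m_neg[of v w] assms by auto
    then show ?thesis using w wc by (simp add: regular_def)
  qed
qed

text \<open>As \<open>energy\<close> increases and \<open>G_m_neg\<close> carries negativity to the
  left, each case reduces to a right endpoint.\<close>

lemma family_regular:
  assumes "family_domain f d \<beta> \<gamma> D"
  shows "D \<subseteq> regular"
proof
  fix v assume v: "v \<in> D"
  from assms consider
      (closed) "case_closed f d \<beta> \<gamma>" "D = {h \<gamma>..h \<beta>} \<inter> {0<..}"
    | (critical) "case_critical f d \<beta> \<gamma>" "D = {h \<gamma>..<v_c f d \<beta> \<gamma>} \<inter> {0<..}"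
    | (zero) "G_m (h \<beta>) = 0" "D = {h \<gamma>..h \<beta>} \<inter> {0<..}"
    | (pos) "G_m (h \<beta>) > 0" "h \<gamma> < v_m f d \<beta>" "D = {h \<gamma>..v_m f d \<beta>} \<inter> {0<..}"
    unfolding family_domain_def by blast
  then show "v \<in> regular"
  proof cases
    case closed
    then have "G_m v < 0" using v G_m_neg[of v "h \<beta>"] by (simp add: case_closed_def)
    moreover have "v \<in> common" "h \<beta> \<in> common"
      using v closed h_\<beta>\<gamma> by (auto simp: common_iff case_closed_def)
    moreover have "energy (h \<beta>) < G_p 1" using closed by (simp add: case_closed_def energy_def)
    then have "energy v < G_p 1"
      using energy_increasing[of v "h \<beta>"] calculation v closed by (cases "v = h \<beta>") auto
    ultimately show ?thesis by (simp add: regular_def)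
  next
    case critical
    note vc = v_c_props[OF critical(1)]
    have "v \<in> common" using v critical vc by (auto simp: common_iff)
    moreover have "G_m v < 0" using v critical vc G_m_neg[of v "h \<beta>"]
      by (simp add: case_critical_def common_iff)
    moreover have "energy v < G_p 1"
      using energy_increasing[of v "v_c f d \<beta> \<gamma>"] vc calculation v critical by auto
    ultimately show ?thesis by (simp add: regular_def)
  next
    case zero
    then show ?thesis using regular_upto_zero[of "h \<beta>" v] v h_\<beta>\<gamma> by simp
  next
    case pos
    then show ?thesis using regular_upto_zero[of "v_m f d \<beta>" v] v v_m_props by simp
  qed
qed

text \<open>The interval makes the limit at \<open>h \<gamma>\<close> a value of \<open>x0\<close>,
  and \<open>G_m (h \<gamma>) \<noteq> 0\<close> makes that value positive.\<close>

lemma family_contains_right_nbhd: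
  assumes "family_domain f d \<beta> \<gamma> D" "h \<gamma> > 0"
  obtains w where "h \<gamma> < w" "{h \<gamma>..w} \<subseteq> D" "G_m (h \<gamma>) \<noteq> 0"
proof -
  from assms consider
      (closed) "case_closed f d \<beta> \<gamma>" "D = {h \<gamma>..h \<beta>} \<inter> {0<..}"
    | (critical) "case_critical f d \<beta> \<gamma>" "D = {h \<gamma>..<v_c f d \<beta> \<gamma>} \<inter> {0<..}"
    | (zero) "G_m (h \<beta>) = 0" "D = {h \<gamma>..h \<beta>} \<inter> {0<..}"
    | (pos) "G_m (h \<beta>) > 0" "h \<gamma> < v_m f d \<beta>" "D = {h \<gamma>..v_m f d \<beta>} \<inter> {0<..}"
    unfolding family_domain_def by blast
  then show ?thesis
  proof cases
    case closed
    then show ?thesis using that[of "h \<beta>"] G_m_neg[of "h \<gamma>" "h \<beta>"] assms h_\<beta>\<gamma>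
      by (auto simp: case_closed_def subset_eq)
  next
    case critical
    note vc = v_c_props[OF critical(1)]
    obtain w where "h \<gamma> < w" "w < v_c f d \<beta> \<gamma>" using vc(2) dense[of "h \<gamma>"] by auto
    then show ?thesis using that[of w] G_m_neg[of "h \<gamma>" "h \<beta>"] assms h_\<beta>\<gamma> critical
      by (auto simp: case_critical_def subset_eq)
  next
    case zero
    then show ?thesis
      using that[of "h \<beta>"] G_m_neg[of "h \<gamma>" "h \<beta>"] assms h_\<beta>\<gamma> by (auto simp: subset_eq)
  next
    case pos
    then show ?thesis
      using that[of "v_m f d \<beta>"] G_m_neg[of "h \<gamma>" "v_m f d \<beta>"] assms v_m_props
      by (auto simp: subset_eq)
  qed
qed

section \<open>Behaviour of \<open>x0\<close> near \<open>0\<close> and near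
  \<open>v_c\<close>\<close>

lemma regular_near_0:
  assumes "h \<gamma> < 0"
  obtains w where "0 < w" "{0..w} \<subseteq> regular"
proof -
  define hi where "hi = min (h \<beta>) 1"
  have hi: "hi > 0" "common = {0..hi}"
    using assms h_\<beta>\<gamma> by (auto simp: common_def hi_def)
  have "(energy \<longlongrightarrow> energy 0) (at_right 0)"
    using energy_cont hi by (auto simp: continuous_on_def simp flip: at_within_Icc_at_right)
  moreover have E0: "energy 0 < G_p 1" using energy_bottom assms by simp
  ultimately have "eventually (\<lambda>v. energy v < G_p 1) (at_right 0)"
    by (rule order_tendstoD(2))
  then obtain e where e: "e > 0" "\<And>v. 0 < v \<Longrightarrow> v < e \<Longrightarrow> energy v < G_p 1"
    unfolding eventually_at_right_field by auto
  \<comment> \<open>The three bounds keep \<open>energy\<close> below \<open>G_p 1\<close>, keep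
    \<open>v\<close> in \<open>common\<close>, and keep \<open>G_m\<close> decreasing, hence
    negative.\<close>
  define w where "w = Min {e / 2, hi, h (min a \<beta>)}"
  have w: "w \<le> e / 2" "w \<le> hi" "w \<le> h (min a \<beta>)" "w > 0"
    using e hi h_min by (auto simp: w_def)
  have "v \<in> regular" if v: "v \<in> {0..w}" for v
  proof (cases "v = 0")
    case True
    then show ?thesis
      using hi E0 G_m_0 h_max assms by (auto simp: regular_def)
  next
    case False
    then have "G_m v < 0" using G_m_decreasing[of 0 v] v w G_m_0 by auto
    then show ?thesis using False v w e by (auto simp: regular_def hi)
  qed
  then show ?thesis using that[of w] w by blast
qed

text \<open>The energy tends to \<open>G_p 1\<close>, so the turning point tends to
  \<open>1\<close>, while \<open>1 - v\<close> tends to \<open>1 - v_c > 0\<close>. The quotient in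
  \<open>transit_lower_bound\<close> therefore blows up.\<close>

lemma x0_at_v_c:
  assumes crit: "case_critical f d \<beta> \<gamma>"
  shows "filterlim (x0 f d \<beta> \<gamma>) at_top (at_left (v_c f d \<beta> \<gamma>))"
proof -
  define c where "c = v_c f d \<beta> \<gamma>"
  define lo where "lo = max 0 (h \<gamma>)"
  have c: "c \<in> common" "lo < c" "c < 1" "energy c = G_p 1"
    using v_c_props[OF crit] by (simp_all add: c_def lo_def)
  have sub: "{lo..c} \<subseteq> common" using c by (auto simp: common_def lo_def)
  have reg: "v \<in> regular \<and> G_m v < 0" if v: "v \<in> {lo<..<c}" for v
  proof -
    have "G_m v < 0" using G_m_neg[of v "h \<beta>"] v c crit
      by (auto simp: case_critical_def common_def lo_def)
    moreover have "v \<in> common" using sub v by auto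
    moreover have "energy v < G_p 1" using energy_increasing[of v c] calculation c v by auto
    ultimately show ?thesis by (simp add: regular_def)
  qed
  have ev: "eventually (\<lambda>v. v \<in> {lo<..<c}) (at_left c)"
    using c(2) eventually_at_left_field by (auto intro!: exI[of _ lo])
  have b1: "G_p (h (max a \<gamma>)) < G_p 1"
    using well.P_increasing[of "h (max a \<gamma>)" 1] well.b_less_B by simp
  have "(energy \<longlongrightarrow> energy c) (at c within {lo..c})"
    using continuous_on_subset[OF energy_cont sub] c(2) by (simp add: continuous_on_def)
  then have "(energy \<longlongrightarrow> G_p 1) (at_left c)"
    using c(2,4) by (simp add: at_within_Icc_at_left)
  moreover have "eventually (\<lambda>v. energy v \<in> {G_p (h (max a \<gamma>))..G_p 1}) (at_left c)"
    using ev
  proof eventually_elim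
    case (elim v)
    then show ?case
      using well.admissible_energy[OF regular_admissible, of v] reg[of v] by (simp add: energy_def)
  qed
  ultimately have "((\<lambda>v. well.turn (energy v)) \<longlongrightarrow> well.turn (G_p 1)) (at_left c)"
    using b1 by (intro continuous_on_tendsto_compose[OF well.turn_cont]) auto
  then have turn: "((\<lambda>v. well.turn (energy v)) \<longlongrightarrow> 1) (at_left c)"
    using well.turn_P[of 1] well.b_less_B by simp
  have t1: "well.turn (energy v) < 1" if "v \<in> {lo<..<c}" for v
    using well.turn_strict_mem[OF regular_admissible, of v] reg[OF that] by (simp add: energy_def)
  have "filterlim (\<lambda>v. inverse (1 - well.turn (energy v))) at_top (at_left c)"
  proof (rule filterlim_inverse_at_top)
    show "((\<lambda>v. 1 - well.turn (energy v)) \<longlongrightarrow> 0) (at_left c)"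
      using tendsto_diff[OF tendsto_const[of 1] turn] by simp
    show "eventually (\<lambda>v. 0 < 1 - well.turn (energy v)) (at_left c)"
      using ev by eventually_elim (simp add: t1)
  qed
  moreover have "((\<lambda>v. 1 - v) \<longlongrightarrow> 1 - c) (at_left c)" by (intro tendsto_intros)
  ultimately have "filterlim (\<lambda>v. (1 - v) * inverse (1 - well.turn (energy v))) at_top (at_left c)"
    using c by (intro filterlim_tendsto_pos_mult_at_top) auto
  then have "filterlim (\<lambda>v. ln ((1 - v) * inverse (1 - well.turn (energy v)))) at_top (at_left c)"
    by (rule filterlim_compose[OF ln_at_top])
  moreover have "eventually (\<lambda>v. ln ((1 - v) * inverse (1 - well.turn (energy v))) \<le> x0 f d \<beta> \<gamma> v)
      (at_left c)"
    using ev
  proof eventually_elim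
    case (elim v)
    note v = reg[OF elim]
    \<comment> \<open>The slope bound of \<open>transit_lower_bound\<close> is just
      \<open>q_plus w \<le> 1\<close>.\<close>
    have "q_plus w - w \<le> 1 - w" if "w \<in> {h \<gamma>..1}" for w
      using q_plus_mem[OF that] by simp
    then have "ln ((1 - v) / (1 - well.turn (G_p v + - G_m v))) \<le> well.transit v (- G_m v)"
      using v by (intro well.transit_lower_bound regular_admissible) auto
    then show ?case using v x0_eq by (simp add: energy_def divide_inverse)
  qed
  ultimately have "filterlim (x0 f d \<beta> \<gamma>) at_top (at_left c)"
    by (rule filterlim_at_top_mono)
  then show ?thesis by (simp add: c_def)
qed

end

theorem lemma3p8:
  fixes f :: "real \<Rightarrow> real" and d a \<beta> \<gamma> :: real and D :: "real set"
  assumes "d > 0"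
    and "smooth f"
    and "0 < a" "a < 1"
    and "f 0 = 0" "f a = 0" "f 1 = 0"
    and "\<And>u. u \<in> {0<..<a} \<Longrightarrow> f u < 0"
    and "\<And>u. u \<in> {a<..<1} \<Longrightarrow> f u > 0"
    and "deriv f 0 < 0" "deriv f 1 < 0" "deriv f a > 0"
    and "integral {0..1} f > 0"
    and "0 < \<beta>" "\<beta> < \<gamma>" "\<gamma> < 1"
    and "\<And>u. u \<in> {0..<\<beta>} \<union> {\<gamma><..1} \<Longrightarrow> deriv (g f d) u > 0"
    and "\<And>u. u \<in> {\<beta><..<\<gamma>} \<Longrightarrow> deriv (g f d) u < 0"
    and "deriv (g f d) \<beta> = 0" "deriv (g f d) \<gamma> = 0"
    and "jump_family f d \<beta> \<gamma> D"
  shows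
    "(g f d \<gamma> < 0 \<longrightarrow> (x0 f d \<beta> \<gamma> \<longlongrightarrow> 0) (at_right 0)) \<and>
     (g f d \<gamma> > 0 \<longrightarrow> (\<exists>C>0. (x0 f d \<beta> \<gamma> \<longlongrightarrow> C) (at_right (g f d \<gamma>)))) \<and>
     (case_critical f d \<beta> \<gamma> \<longrightarrow> filterlim (x0 f d \<beta> \<gamma>) at_top (at_left (v_c f d \<beta> \<gamma>))) \<and>
     (\<forall>v0\<in>D. 0 \<le> x0 f d \<beta> \<gamma> v0 \<and> (G_minus f d \<beta> v0 \<noteq> 0 \<longrightarrow> 0 < x0 f d \<beta> \<gamma> v0)) \<and>
     continuous_on D (x0 f d \<beta> \<gamma>)"
proof -
  interpret bistable f d a \<beta> \<gamma>
    using assms by unfold_locales auto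
  have D: "family_domain f d \<beta> \<gamma> D" using assms by (simp add: jump_family_def)
  note reg = family_regular[OF D]
  have "(x0 f d \<beta> \<gamma> \<longlongrightarrow> 0) (at_right 0)" if neg: "h \<gamma> < 0"
  proof -
    obtain w where w: "0 < w" "{0..w} \<subseteq> regular" by (rule regular_near_0[OF neg])
    \<comment> \<open>The orbit at \<open>0\<close> is degenerate because
      \<open>G_m 0 = 0\<close>.\<close>
    then have "x0 f d \<beta> \<gamma> 0 = 0" using G_m_0 by (intro x0_zero) auto
    then show ?thesis using x0_tendsto_at_right[OF w] by simp
  qed
  moreover have "\<exists>C>0. (x0 f d \<beta> \<gamma> \<longlongrightarrow> C) (at_right (h \<gamma>))" if pos: "h \<gamma> > 0"
  proof -
    obtain w where w: "h \<gamma> < w" "{h \<gamma>..w} \<subseteq> D" "G_m (h \<gamma>) \<noteq> 0"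
      by (rule family_contains_right_nbhd[OF D pos])
    then have "{h \<gamma>..w} \<subseteq> regular" using reg by blast
    moreover from this have "0 < x0 f d \<beta> \<gamma> (h \<gamma>)" using w by (intro x0_pos) auto
    ultimately show ?thesis using x0_tendsto_at_right[OF w(1)] by blast
  qed
  moreover have "0 \<le> x0 f d \<beta> \<gamma> v \<and> (G_m v \<noteq> 0 \<longrightarrow> 0 < x0 f d \<beta> \<gamma> v)" if "v \<in> D" for v
    using x0_pos[of v] x0_zero[of v] reg that by (cases "G_m v = 0") auto
  moreover have "continuous_on D (x0 f d \<beta> \<gamma>)"
    using continuous_on_subset[OF x0_cont reg] .
  ultimately show ?thesis using x0_at_v_c by blast
qed

end
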